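(* Suppose every $f_i$ is convex, every $\Omega_i$ is nonempty, closed and convex, the graph $\mathcal G$ is connected, the matrix $\mathbf{L}=U^\top U$ satisfies the graph and null-space conditions given in the context, the solution set $\mathcal X^*$ of the resource allocation problem is nonempty, and the Slater condition in the context holds. Let the parameters $\beta_i>0$ ($i=1,\dots,n$) and $c>0$ be such that $B-c\mathbf{L}\succ 0$. Then $\mathcal M\succ 0$, and the sequences $\{\mathbf x^k\}$, $\{\mathbf q^k\}$ generated by Mirror-P-EXTRA satisfy $$\|\mathbf z^k-\mathbf z^{k+1}\|_{\mathcal M}^2\le \|\mathbf z^k-\mathbf z^*\|_{\mathcal M}^2-\|\mathbf z^{k+1}-\mathbf z^*\|_{\mathcal M}^2,\qquad k=0,1,\dots,$$ for every $\mathbf z^*=\mathbf z(\mathbf x^* )$ associated with a solution $\mathbf x^*\in\mathcal X^*$ as described in the context. Furthermore, $\{\mathbf x^k\}$ converges to a point of $\mathcal X^*$.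
   Context: Problem. There are $n$ agents; agent $i$ has $f_i:\mathbb R^p\to\mathbb R$, a set $\Omega_i\subseteq\mathbb R^p$ and a vector $r_i\in\mathbb R^p$. The resource allocation problem is: minimize $\sum_{i=1}^n f_i(x_i)$ subject to $\sum_{i=1}^n(x_i-r_i)=0$ and $x_i\in\Omega_i$ for all $i$. Its solution set is $\mathcal X^*$. Points are written as matrices $\mathbf x\in\mathbb R^{n\times p}$ with $i$-th row $x_i^\top$; likewise $\mathbf r$ has rows $r_i^\top$. Let $h_i=f_i+g_i$, where $g_i$ is the indicator function of $\Omega_i$ ($0$ on $\Omega_i$, $+\infty$ outside). Slater condition: there is $\tilde{\mathbf x}$ satisfying $\sum_i(\tilde x_i-r_i)=0$ and lying in the relative interior of $\Omega_1\times\cdots\times\Omega_n$. Graph. $\mathcal G$ is a simple undirected graph on $\{1,\dots,n\}$ with edge set $\mathcal E$ and neighbor sets $\mathcal N_i$. The $n\times n$ matrix $\mathbf L=[L_{ij}]$ is compatible with $\mathcal G$ (that is, $L_{ij}=0$ whenever $i\ne j$ and $\{i,j\}\notin\mathcal E$) and $\mathbf L=U^\top U$ for some full-row-rank $U\in\mathbb R^{(n-1)\times n}$ with null space $\{a\mathbf 1: a\in\mathbb R\}$, where $\mathbf 1$ is the all-ones vector. Algorithm (Mirror-P-EXTRA). Each agent $i$ has $\beta_i>0$; all share $c>0$; $B=\mathrm{diag}(\beta_1,\dots,\beta_n)$. Initialize $x_i^0\in\Omega_i$, $s_i^0$ a subgradient of $f_i$ at $x_i^0$, $y_i^{-1}=0$.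 For $k=0,1,\dots$: $y_i^k=y_i^{k-1}+\sum_{j\in\mathcal N_i\cup\{i\}}L_{ij}s_j^k$; $x_i^{k+1}=\arg\min_{x_i\in\Omega_i}\{f_i(x_i)-\langle s_i^k,x_i\rangle+\frac1{2\beta_i}\|x_i-r_i+2cy_i^k-cy_i^{k-1}\|_2^2\}$; $s_i^{k+1}=s_i^k-\frac1{\beta_i}(x_i^{k+1}-r_i+2cy_i^k-cy_i^{k-1})$. Let $\widetilde\nabla\mathbf h(\mathbf x^k)$ denote the matrix with rows $(s_i^k)^\top$ (each $s_i^k$ is a subgradient of $h_i$ at $x_i^k$). Define $\mathbf q^{-1}=0$ and $\mathbf q^{k}=\mathbf q^{k-1}+U\widetilde\nabla\mathbf h(\mathbf x^k)$ for $k\ge0$. Set $$\mathcal M=\begin{pmatrix}cI&0\\0&B-c\mathbf L\end{pmatrix},\quad \mathbf z^k=\begin{pmatrix}\mathbf q^k\\ \widetilde\nabla\mathbf h(\mathbf x^k)\end{pmatrix},\quad \mathbf z^*=\mathbf z(\mathbf x^* )=\begin{pmatrix}\mathbf q^*\\ \widetilde\nabla\mathbf h(\mathbf x^* )\end{pmatrix},$$ where $\mathbf x^*\in\mathcal X^*$, $\widetilde\nabla\mathbf h(\mathbf x^* )$ is a matrix whose $i$-th row is (the transpose of) a subgradient of $h_i$ at $x_i^*$, and $\mathbf q^*\in\mathbb R^{(n-1)\times p}$, with $\mathbf x^*-\mathbf r+cU^\top\mathbf q^*=0$ and $U\widetilde\nabla\mathbf h(\mathbf x^* )=0$ (the optimality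 conditions). For positive semidefinite $\mathcal M$, $\|A\|_{\mathcal M}=\sqrt{\mathrm{Trace}(A^\top\mathcal M A)}$. *)

theory Defs
  imports "HOL-Analysis.Analysis"
begin

text \<open>
  Agents are the elements of the finite type \<open>'n\<close>, so \<open>n = CARD('n) \<ge> 1\<close>. A point
  of \<open>\<real>\<^sup>n\<^sup>\<times>\<^sup>p\<close> is an element of \<open>real^'p^'n\<close>, whose component \<open>x $ i\<close> is
  the \<open>i\<close>-th row.
\<close>

definition feasible :: "real^'p^'n \<Rightarrow> ('n \<Rightarrow> (real^'p) set) \<Rightarrow> (real^'p^'n) set" where
  "feasible r \<Omega> = {x. (\<Sum>i\<in>UNIV. x $ i - r $ i) = 0 \<and> (\<forall>i. x $ i \<in> \<Omega> i)}"

definition solutions ::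
  "('n \<Rightarrow> real^'p \<Rightarrow> real) \<Rightarrow> real^'p^'n \<Rightarrow> ('n \<Rightarrow> (real^'p) set) \<Rightarrow> (real^'p^'n) set" where
  "solutions f r \<Omega> =
     {x. is_arg_min (\<lambda>x. \<Sum>i\<in>UNIV. f i (x $ i)) (\<lambda>x. x \<in> feasible r \<Omega>) x}"

definition slater :: "real^'p^'n \<Rightarrow> ('n \<Rightarrow> (real^'p) set) \<Rightarrow> bool" where
  "slater r \<Omega> \<longleftrightarrow>
     (\<exists>x. (\<Sum>i\<in>UNIV. x $ i - r $ i) = 0 \<and> x \<in> rel_interior {x. \<forall>i. x $ i \<in> \<Omega> i})"

definition ind_fun :: "'a set \<Rightarrow> 'a \<Rightarrow> ereal" where
  "ind_fun S x = (if x \<in> S then 0 else \<infinity>)"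

definition h_fun :: "('a \<Rightarrow> real) \<Rightarrow> 'a set \<Rightarrow> 'a \<Rightarrow> ereal" where
  "h_fun f S x = ereal (f x) + ind_fun S x"

definition is_subgradient :: "('a::real_inner \<Rightarrow> ereal) \<Rightarrow> 'a \<Rightarrow> 'a \<Rightarrow> bool" where
  "is_subgradient h x s \<longleftrightarrow>
     \<bar>h x\<bar> \<noteq> \<infinity> \<and> (\<forall>y. h x + ereal (s \<bullet> (y - x)) \<le> h y)"

definition simple_graph :: "'n set set \<Rightarrow> bool" where
  "simple_graph E \<longleftrightarrow> (\<forall>e\<in>E. card e = 2)"

definition neighbors :: "'n set set \<Rightarrow> 'n \<Rightarrow> 'n set" where
  "neighbors E i = {j. {i, j} \<in> E}"

definition graph_connected :: "'n set set \<Rightarrow> bool" where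
  "graph_connected E \<longleftrightarrow> (\<forall>i j. (i, j) \<in> {(a, b). {a, b} \<in> E}\<^sup>*)"

definition graph_compatible :: "'n set set \<Rightarrow> real^'n^'n \<Rightarrow> bool" where
  "graph_compatible E L \<longleftrightarrow> (\<forall>i j. i \<noteq> j \<and> {i, j} \<notin> E \<longrightarrow> L $ i $ j = 0)"

text \<open>
  The \<open>(n-1) \<times> n\<close> matrix \<open>U\<close> is given by its rows \<open>U l\<close> for \<open>l < CARD('n) - 1\<close>, and
  likewise matrices with \<open>n-1\<close> rows and \<open>p\<close> columns are functions \<open>nat \<Rightarrow> real^'p\<close>;
  values at other indices are never used. A type for the row indices would rule out \<open>n = 1\<close>,
  where \<open>U\<close> has no rows.
\<close>

definition full_row_rank :: "(nat \<Rightarrow> real^'n) \<Rightarrow> bool" where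
  "full_row_rank U \<longleftrightarrow> dim (U ` {..<CARD('n) - 1}) = CARD('n) - 1"

definition null_space_U :: "(nat \<Rightarrow> real^'n) \<Rightarrow> (real^'n) set" where
  "null_space_U U = {v. \<forall>l<CARD('n) - 1. U l \<bullet> v = 0}"

definition gram_U :: "(nat \<Rightarrow> real^'n) \<Rightarrow> real^'n^'n" where
  "gram_U U = (\<chi> i j. \<Sum>l<CARD('n) - 1. U l $ i * U l $ j)"

definition U_times :: "(nat \<Rightarrow> real^'n) \<Rightarrow> real^'p^'n \<Rightarrow> nat \<Rightarrow> real^'p" where
  "U_times U s l = (\<Sum>j\<in>UNIV. U l $ j *\<^sub>R s $ j)"

definition Ut_times :: "(nat \<Rightarrow> real^'n) \<Rightarrow> (nat \<Rightarrow> real^'p) \<Rightarrow> real^'p^'n" where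
  "Ut_times U q = (\<chi> i. \<Sum>l<CARD('n) - 1. U l $ i *\<^sub>R q l)"

definition diag_mat :: "('n \<Rightarrow> real) \<Rightarrow> real^'n^'n" where
  "diag_mat \<beta> = (\<chi> i j. if i = j then \<beta> i else 0)"

text \<open>
  The dual sequences start at index \<open>-1\<close> in the algorithm, so they are shifted by one here:
  \<open>y 0\<close> is \<open>y\<^sup>-\<^sup>1\<close> and \<open>y (Suc k)\<close> is \<open>y\<^sup>k\<close>; the same holds for \<open>q_seq\<close>.
\<close>

definition mirror_p_extra ::
  "('n \<Rightarrow> real^'p \<Rightarrow> real) \<Rightarrow> ('n \<Rightarrow> (real^'p) set) \<Rightarrow> real^'p^'n \<Rightarrow> 'n set set \<Rightarrow> real^'n^'n \<Rightarrow>
   ('n \<Rightarrow> real) \<Rightarrow> real \<Rightarrow>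
   (nat \<Rightarrow> real^'p^'n) \<Rightarrow> (nat \<Rightarrow> real^'p^'n) \<Rightarrow> (nat \<Rightarrow> real^'p^'n) \<Rightarrow> bool" where
  "mirror_p_extra f \<Omega> r E L \<beta> c x s y \<longleftrightarrow>
     (\<forall>i. x 0 $ i \<in> \<Omega> i) \<and>
     (\<forall>i. is_subgradient (\<lambda>v. ereal (f i v)) (x 0 $ i) (s 0 $ i)) \<and>
     (\<forall>i. y 0 $ i = 0) \<and>
     (\<forall>k i.
        y (Suc k) $ i = y k $ i + (\<Sum>j\<in>neighbors E i \<union> {i}. L $ i $ j *\<^sub>R s k $ j) \<and>
        is_arg_min
          (\<lambda>v. f i v - s k $ i \<bullet> v
             + 1 / (2 * \<beta> i) * (norm (v - r $ i + (2 * c) *\<^sub>R y (Suc k) $ i - c *\<^sub>R y k $ i))\<^sup>2)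
          (\<lambda>v. v \<in> \<Omega> i) (x (Suc k) $ i) \<and>
        s (Suc k) $ i = s k $ i - (1 / \<beta> i) *\<^sub>R
          (x (Suc k) $ i - r $ i + (2 * c) *\<^sub>R y (Suc k) $ i - c *\<^sub>R y k $ i))"

primrec q_seq :: "(nat \<Rightarrow> real^'n) \<Rightarrow> (nat \<Rightarrow> real^'p^'n) \<Rightarrow> nat \<Rightarrow> nat \<Rightarrow> real^'p" where
  "q_seq U s 0 = (\<lambda>l. 0)"
| "q_seq U s (Suc k) = (\<lambda>l. q_seq U s k l + U_times U (s k) l)"

text \<open>
  Square matrices of size \<open>(n-1) + n\<close> are functions on the index set
  \<open>{..<CARD('n) - 1} <+> UNIV\<close>.
\<close>

definition pos_def_on :: "'i set \<Rightarrow> ('i \<Rightarrow> 'i \<Rightarrow> real) \<Rightarrow> bool" where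
  "pos_def_on I A \<longleftrightarrow>
     (\<forall>a\<in>I. \<forall>b\<in>I. A a b = A b a) \<and>
     (\<forall>v. (\<exists>a\<in>I. v a \<noteq> 0) \<longrightarrow> 0 < (\<Sum>a\<in>I. \<Sum>b\<in>I. v a * A a b * v b))"

definition pos_def :: "real^'n^'n \<Rightarrow> bool" where
  "pos_def A \<longleftrightarrow> pos_def_on UNIV (\<lambda>i j. A $ i $ j)"

definition block_idx :: "(nat + 'n) set" where
  "block_idx = {..<CARD('n) - 1} <+> (UNIV :: 'n set)"

fun block_M :: "real \<Rightarrow> real^'n^'n \<Rightarrow> real^'n^'n \<Rightarrow> nat + 'n \<Rightarrow> nat + 'n \<Rightarrow> real" where
  "block_M c B L (Inl l) (Inl m) = (if l = m then c else 0)"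
| "block_M c B L (Inl l) (Inr j) = 0"
| "block_M c B L (Inr i) (Inl m) = 0"
| "block_M c B L (Inr i) (Inr j) = (B - c *\<^sub>R L) $ i $ j"

definition stack :: "(nat \<Rightarrow> real^'p) \<Rightarrow> real^'p^'n \<Rightarrow> nat + 'n \<Rightarrow> real^'p" where
  "stack q s = case_sum q (\<lambda>i. s $ i)"

definition wnorm :: "'i set \<Rightarrow> ('i \<Rightarrow> 'i \<Rightarrow> real) \<Rightarrow> ('i \<Rightarrow> real^'p) \<Rightarrow> real" where
  "wnorm I M A =
     sqrt (trace ((\<chi> u v. \<Sum>a\<in>I. \<Sum>b\<in>I. A a $ u * M a b * A b $ v) :: real^'p^'p))"

definition z_seq :: "(nat \<Rightarrow> real^'n) \<Rightarrow> (nat \<Rightarrow> real^'p^'n) \<Rightarrow> nat \<Rightarrow> nat + 'n \<Rightarrow> real^'p" where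
  "z_seq U s k = stack (q_seq U s (Suc k)) (s k)"

definition is_z_star ::
  "('n \<Rightarrow> real^'p \<Rightarrow> real) \<Rightarrow> ('n \<Rightarrow> (real^'p) set) \<Rightarrow> real^'p^'n \<Rightarrow> (nat \<Rightarrow> real^'n) \<Rightarrow> real \<Rightarrow>
   real^'p^'n \<Rightarrow> (nat + 'n \<Rightarrow> real^'p) \<Rightarrow> bool" where
  "is_z_star f \<Omega> r U c xs zs \<longleftrightarrow>
     (\<exists>q g. zs = stack q g \<and>
        (\<forall>i. is_subgradient (h_fun (f i) (\<Omega> i)) (xs $ i) (g $ i)) \<and>
        xs - r + c *\<^sub>R Ut_times U q = 0 \<and>
        (\<forall>l<CARD('n) - 1. U_times U g l = 0))"

end

theory Submission
  imports Defs
begin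

text \<open>
  Write \<open>P = B - c L\<close> and \<open>z\<^sup>k = (q\<^sup>k, s\<^sup>k)\<close>. Mirror-P-EXTRA is a proximal point method in disguise.
  Fermat's rule for the proximal step (\<open>prox_step_subgradient\<close>) makes \<open>s\<^sup>k\<^sup>+\<^sup>1\<close> a matrix of
  subgradients of the \<open>h\<^sub>i\<close> at \<open>x\<^sup>k\<^sup>+\<^sup>1\<close>. Since \<open>y\<^sup>k = U\<^sup>T q\<^sup>k\<close>, the update of \<open>s\<close> can be rearranged
  (\<open>mirror_p_extra_residual\<close>) into the implicit relations
    \<open>P (s\<^sup>k - s\<^sup>k\<^sup>+\<^sup>1) = x\<^sup>k\<^sup>+\<^sup>1 - r + c U\<^sup>T q\<^sup>k\<^sup>+\<^sup>1\<close> and \<open>q\<^sup>k - q\<^sup>k\<^sup>+\<^sup>1 = - U s\<^sup>k\<^sup>+\<^sup>1\<close>,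
  whose right-hand sides vanish exactly at points satisfying the optimality conditions. Pairing
  them with \<open>z\<^sup>k\<^sup>+\<^sup>1 - z\<^sup>*\<close>, the terms with \<open>U\<close> and \<open>U\<^sup>T\<close> cancel, and the inner product of
  \<open>x\<^sup>k\<^sup>+\<^sup>1 - x\<^sup>*\<close> with \<open>s\<^sup>k\<^sup>+\<^sup>1 - s\<^sup>*\<close> remains, which is nonnegative by monotonicity of
  subdifferentials. This is the claimed inequality (\<open>fejer_identity\<close>).

  Convergence needs one point \<open>z\<^sup>*\<close>. Given a solution, the Slater condition provides a
  Lagrange multiplier for the coupling constraint (\<open>lagrange_multiplier_rel_interior\<close>), which is
  a common subgradient of all \<open>h\<^sub>i\<close>; and \<open>q\<^sup>*\<close> exists because the range of \<open>U\<^sup>T\<close> consists of all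
  matrices whose rows sum to zero (\<open>Ut_times_surj_sum_zero\<close>). As the block matrix is positive
  definite, the inequality then gives boundedness and vanishing steps. Cluster points satisfy
  the optimality conditions, hence belong to solutions (\<open>is_z_star_imp_solution\<close>), and by the
  inequality relative to a cluster point the whole sequence converges
  (\<open>mirror_p_extra_converges\<close>).
\<close>

section \<open>Subgradients of a convex function on a convex set\<close>

lemma is_subgradient_h_fun_iff:
  "is_subgradient (h_fun f S) x g \<longleftrightarrow> x \<in> S \<and> (\<forall>v\<in>S. f x + g \<bullet> (v - x) \<le> f v)"
  unfolding is_subgradient_def h_fun_def ind_fun_def by (auto split: if_splits)

lemma subgradient_monotone:
  assumes "is_subgradient (h_fun f S) x g" and "is_subgradient (h_fun f S) x' g'"
  shows "0 \<le> (x - x') \<bullet> (g - g')"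
proof -
  have "f x + g \<bullet> (x' - x) \<le> f x'" "f x' + g' \<bullet> (x - x') \<le> f x"
    using assms by (auto simp: is_subgradient_h_fun_iff)
  then show ?thesis by (simp add: inner_diff inner_commute)
qed

text \<open>
  Fermat's rule for a proximal step: minus the gradient of the smooth part at the minimizer is
  a subgradient of \<open>f\<close> plus the indicator of \<open>S\<close>. Sum rules for subdifferentials are avoided
  by comparing the minimizer \<open>x\<close> with \<open>(1 - t) x + t v\<close> for
  \<open>v \<in> S\<close>: the objective changes by at most \<open>t (D + t K)\<close>, where \<open>D\<close> is the slack of the
  desired inequality, so \<open>D \<ge> 0\<close> follows as \<open>t\<close> tends to \<open>0\<close>.
\<close>
lemma prox_step_subgradient:
  fixes f :: "'a::real_inner \<Rightarrow> real"
  assumes f: "convex_on UNIV f" and S: "convex S" and "b > 0"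
    and min: "is_arg_min (\<lambda>v. f v - s \<bullet> v + 1 / (2 * b) * (norm (v - w))\<^sup>2) (\<lambda>v. v \<in> S) x"
  shows "is_subgradient (h_fun f S) x (s - (1 / b) *\<^sub>R (x - w))"
proof -
  have x: "x \<in> S" using min by (simp add: is_arg_min_def)
  have "f x + (s - (1 / b) *\<^sub>R (x - w)) \<bullet> (v - x) \<le> f v" if v: "v \<in> S" for v
  proof -
    define D where "D = f v - f x - s \<bullet> (v - x) + (1 / b) * ((x - w) \<bullet> (v - x))"
    define K where "K = 1 / (2 * b) * ((v - x) \<bullet> (v - x))"
    have step: "0 \<le> D + t * K" if t: "0 < t" "t < 1" for t
    proof -
      let ?u = "(1 - t) *\<^sub>R x + t *\<^sub>R v"
      have "?u \<in> S" using convexD[OF S x v, of "1 - t" t] t by simp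
      then have opt: "f x - s \<bullet> x + 1 / (2 * b) * (norm (x - w))\<^sup>2
          \<le> f ?u - s \<bullet> ?u + 1 / (2 * b) * (norm (?u - w))\<^sup>2"
        using min by (auto simp: is_arg_min_linorder)
      have conv: "f ?u \<le> f x + t * (f v - f x)"
        using convex_onD[OF f, of t x v] t by (simp add: algebra_simps)
      have lin: "s \<bullet> ?u = s \<bullet> x + t * (s \<bullet> (v - x))"
        by (simp add: inner_simps algebra_simps)
      have "?u - w = (x - w) + t *\<^sub>R (v - x)" by (simp add: algebra_simps)
      then have "(norm (?u - w))\<^sup>2
          = (norm (x - w))\<^sup>2 + (2 * t * ((x - w) \<bullet> (v - x)) + t\<^sup>2 * ((v - x) \<bullet> (v - x)))"
        by (simp only: power2_norm_eq_inner)
          (simp add: inner_add_left inner_add_right inner_commute power2_eq_square)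
      then have "1 / (2 * b) * (norm (?u - w))\<^sup>2 = 1 / (2 * b) * (norm (x - w))\<^sup>2 +
          1 / (2 * b) * (2 * t * ((x - w) \<bullet> (v - x)) + t\<^sup>2 * ((v - x) \<bullet> (v - x)))"
        by (simp only: distrib_left)
      with opt conv lin have "0 \<le> t * (f v - f x) - t * (s \<bullet> (v - x)) +
          1 / (2 * b) * (2 * t * ((x - w) \<bullet> (v - x)) + t\<^sup>2 * ((v - x) \<bullet> (v - x)))"
        by linarith
      also have "\<dots> = t * (D + t * K)"
        using \<open>b > 0\<close> by (simp add: D_def K_def field_simps power2_eq_square)
      finally show ?thesis using t by (simp add: zero_le_mult_iff)
    qed
    have "((\<lambda>t. D + t * K) \<longlongrightarrow> D + 0 * K) (at_right 0)" by (intro tendsto_intros)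
    moreover have "\<forall>\<^sub>F t in at_right (0::real). 0 \<le> D + t * K"
      using eventually_at_right_real[OF zero_less_one]
      by eventually_elim (auto intro: step)
    ultimately have "0 \<le> D + 0 * K" by (rule tendsto_lowerbound) simp
    then show ?thesis by (simp add: D_def inner_diff_left)
  qed
  with x show ?thesis by (simp add: is_subgradient_h_fun_iff)
qed

text \<open>
  The graph of the subdifferential is closed, because a finite convex function on a
  Euclidean space is continuous. This identifies cluster points of the iteration as optimal.
\<close>
lemma subgradient_limit:
  fixes f :: "'a::euclidean_space \<Rightarrow> real"
  assumes f: "convex_on UNIV f" and S: "closed S"
    and sub: "\<And>k. is_subgradient (h_fun f S) (x k) (g k)"
    and x: "x \<longlonglongrightarrow> x'" and g: "g \<longlonglongrightarrow> g'"
  shows "is_subgradient (h_fun f S) x' g'"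
proof -
  have "x' \<in> S"
    using closed_sequentially[OF S _ x] sub by (simp add: is_subgradient_h_fun_iff)
  moreover have "f x' + g' \<bullet> (v - x') \<le> f v" if "v \<in> S" for v
  proof (rule LIMSEQ_le_const2)
    have "isCont f x'"
      using convex_on_continuous[OF open_UNIV f] continuous_on_eq_continuous_at by blast
    then show "(\<lambda>k. f (x k) + g k \<bullet> (v - x k)) \<longlonglongrightarrow> f x' + g' \<bullet> (v - x')"
      by (intro tendsto_intros x g isCont_tendsto_compose[OF _ x])
    show "\<exists>N. \<forall>n\<ge>N. f (x n) + g n \<bullet> (v - x n) \<le> f v"
      using sub that by (simp add: is_subgradient_h_fun_iff)
  qed
  ultimately show ?thesis by (simp add: is_subgradient_h_fun_iff)
qed

section \<open>Lagrange multipliers\<close>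

text \<open>
  The set \<open>C\<close> of all pairs (constraint violation, upper bound on the loss of value against
  \<open>xs\<close>) is convex, and \<open>(0, 0)\<close> lies on its relative boundary since \<open>xs\<close> is optimal. A supporting
  hyperplane \<open>(a, \<tau>)\<close> there yields the multiplier \<open>- a / \<tau>\<close> once \<open>\<tau> > 0\<close>. If \<open>\<tau>\<close> vanished,
  \<open>a\<close> would be nonnegative on all violations; since \<open>x0\<close> is a relative interior point with
  violation \<open>0\<close>, segments of \<open>X\<close> through \<open>x0\<close> can be prolonged and \<open>a\<close> would vanish on all
  violations, which contradicts the strictness of the hyperplane on the relative interior of \<open>C\<close>.
\<close>
lemma lagrange_multiplier_rel_interior:
  fixes F :: "'a::euclidean_space \<Rightarrow> real" and T :: "'a \<Rightarrow> 'b::euclidean_space"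
  assumes T: "linear T" and X: "convex X" and F: "convex_on X F"
    and x0: "x0 \<in> rel_interior X" "T x0 = b"
    and xs: "xs \<in> X" "T xs = b" and min: "\<And>x. x \<in> X \<Longrightarrow> T x = b \<Longrightarrow> F xs \<le> F x"
  obtains lam where "\<And>x. x \<in> X \<Longrightarrow> F xs + lam \<bullet> (T x - b) \<le> F x"
proof -
  interpret T: linear T by (rule T)
  define C where "C = {(u, t). \<exists>x\<in>X. u = T x - b \<and> F x - F xs \<le> t}"
  have C: "convex C"
  proof (rule convexI)
    fix p q :: "'b \<times> real" and \<mu> \<nu> :: real
    assume pq: "p \<in> C" "q \<in> C" and w: "0 \<le> \<mu>" "0 \<le> \<nu>" "\<mu> + \<nu> = 1"
    obtain x y where x: "x \<in> X" "fst p = T x - b" "F x - F xs \<le> snd p"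
      and y: "y \<in> X" "fst q = T y - b" "F y - F xs \<le> snd q"
      using pq by (auto simp: C_def split_beta)
    let ?z = "\<mu> *\<^sub>R x + \<nu> *\<^sub>R y"
    have z: "?z \<in> X" using convexD[OF X x(1) y(1) w] .
    have \<mu>: "\<mu> = 1 - \<nu>" using w by simp
    have "F ?z \<le> \<mu> * F x + \<nu> * F y"
      using convex_onD[OF F, of \<nu> x y] w x(1) y(1) unfolding \<mu> by simp
    also have "\<dots> \<le> \<mu> * (F xs + snd p) + \<nu> * (F xs + snd q)"
      using x(3) y(3) w by (intro add_mono mult_left_mono) auto
    also have "\<dots> = F xs + (\<mu> * snd p + \<nu> * snd q)"
      unfolding \<mu> by (simp add: algebra_simps)
    finally have "F ?z - F xs \<le> \<mu> * snd p + \<nu> * snd q" by simp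
    moreover have "\<mu> *\<^sub>R fst p + \<nu> *\<^sub>R fst q = \<mu> *\<^sub>R T x + \<nu> *\<^sub>R T y - (\<mu> + \<nu>) *\<^sub>R b"
      unfolding x(2) y(2) by (simp add: algebra_simps)
    then have "\<mu> *\<^sub>R fst p + \<nu> *\<^sub>R fst q = T ?z - b"
      using w(3) by (simp add: T.add T.scaleR)
    ultimately show "\<mu> *\<^sub>R p + \<nu> *\<^sub>R q \<in> C"
      using z by (auto simp: C_def split_beta)
  qed
  have C0: "(0, t) \<in> C" if "t \<ge> 0" for t using xs that by (force simp: C_def)
  have Cneg: "(0, t) \<notin> C" if "t < 0" for t using min that by (force simp: C_def)
  have nri: "(0, 0) \<notin> rel_interior C"
  proof
    assume "(0, 0) \<in> rel_interior C"
    \<comment> \<open>Prolonging the segment from \<open>(0, 1)\<close> beyond \<open>(0, 0)\<close> would reach a negative loss of value.\<close>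
    then obtain e :: real where "e > 1" "(1 - e) *\<^sub>R (0, 1) + e *\<^sub>R (0, 0) \<in> C"
      using convex_rel_interior_iff[OF C, of "(0, 0)"] C0[of 1] by force
    then show False using Cneg[of "1 - e"] by simp
  qed
  obtain d where "d \<noteq> 0" and d: "\<And>p. p \<in> C \<Longrightarrow> d \<bullet> (0, 0) \<le> d \<bullet> p"
      "\<And>p. p \<in> rel_interior C \<Longrightarrow> d \<bullet> (0, 0) < d \<bullet> p"
    by (rule supporting_hyperplane_rel_boundary[OF C C0[OF order_refl] nri]) (rule that)
  obtain a \<tau> where dd: "d = (a, \<tau>)" by (cases d)
  have pos: "0 \<le> a \<bullet> (T x - b) + \<tau> * t" if "x \<in> X" "F x - F xs \<le> t" for x t
    using d(1)[of "(T x - b, t)"] that by (auto simp: C_def dd)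
  have "\<tau> \<noteq> 0"
  proof
    assume "\<tau> = 0"
    have flat: "a \<bullet> (T x - b) = 0" if x: "x \<in> X" for x
    proof -
      obtain e where e: "e > 1" "(1 - e) *\<^sub>R x + e *\<^sub>R x0 \<in> X"
        using convex_rel_interior_iff[OF X, of x0] x0 x by blast
      have "T ((1 - e) *\<^sub>R x + e *\<^sub>R x0) - b = (1 - e) *\<^sub>R T x + e *\<^sub>R b - b"
        using x0(2) by (simp only: T.add T.scaleR)
      also have "\<dots> = (1 - e) *\<^sub>R (T x - b)"
        by (simp add: algebra_simps)
      finally have "T ((1 - e) *\<^sub>R x + e *\<^sub>R x0) - b = (1 - e) *\<^sub>R (T x - b)" .
      then have "0 \<le> (1 - e) * (a \<bullet> (T x - b))"
        using pos[OF e(2) order_refl] \<open>\<tau> = 0\<close> by simp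
      moreover have "0 \<le> a \<bullet> (T x - b)" using pos[OF x order_refl] \<open>\<tau> = 0\<close> by simp
      ultimately show ?thesis using e(1) by (simp add: zero_le_mult_iff)
    qed
    obtain p where "p \<in> rel_interior C" using rel_interior_eq_empty[OF C] C0[of 0] by auto
    then show False
      using d(2)[of p] rel_interior_subset[of C] flat
      by (auto simp: C_def dd \<open>\<tau> = 0\<close>)
  qed
  moreover have "0 \<le> \<tau>" using pos[OF xs(1), of 1] xs(2) by simp
  ultimately have \<tau>: "\<tau> > 0" by simp
  show thesis
  proof
    fix x assume "x \<in> X"
    from pos[OF this order_refl] have "0 \<le> (a \<bullet> (T x - b) + \<tau> * (F x - F xs)) / \<tau>"
      using \<tau> by simp
    then show "F xs + (- (1 / \<tau>) *\<^sub>R a) \<bullet> (T x - b) \<le> F x"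
      using \<tau> by (simp add: field_simps)
  qed
qed

text \<open>
  The objective is separable, so a multiplier for the coupling constraint is a subgradient
  of every \<open>h\<^sub>i\<close> at the same time: it suffices to vary one row of the solution.
\<close>
lemma solution_common_subgradient:
  fixes f :: "'n::finite \<Rightarrow> real^'p::finite \<Rightarrow> real"
  assumes f: "\<And>i. convex_on UNIV (f i)" and \<Omega>: "\<And>i. convex (\<Omega> i)"
    and xs: "xs \<in> solutions f r \<Omega>" and "slater r \<Omega>"
  obtains lam where "\<And>i. is_subgradient (h_fun (f i) (\<Omega> i)) (xs $ i) lam"
proof -
  let ?X = "{x. \<forall>i. x $ i \<in> \<Omega> i}" and ?F = "\<lambda>x. \<Sum>i\<in>UNIV. f i (x $ i)"
  let ?T = "\<lambda>x :: real^'p^'n. \<Sum>i\<in>UNIV. x $ i" and ?b = "\<Sum>i\<in>UNIV. r $ i"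
  have xsX: "xs \<in> ?X" and xsT: "?T xs = ?b"
    and xsmin: "\<And>x. x \<in> ?X \<Longrightarrow> ?T x = ?b \<Longrightarrow> ?F xs \<le> ?F x"
    using xs by (auto simp: solutions_def is_arg_min_linorder feasible_def sum_subtractf)
  obtain x0 where x0: "x0 \<in> rel_interior ?X" "?T x0 = ?b"
    using \<open>slater r \<Omega>\<close> by (auto simp: slater_def sum_subtractf)
  have T: "linear ?T"
    by (rule linearI) (simp_all add: sum.distrib scaleR_sum_right)
  have X: "convex ?X"
    using \<Omega> by (auto simp: convex_def)
  have F: "convex_on ?X ?F"
  proof (rule convex_onI[OF _ X])
    fix t :: real and x y :: "real^'p^'n" assume t: "0 < t" "t < 1"
    have "?F ((1 - t) *\<^sub>R x + t *\<^sub>R y)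
        \<le> (\<Sum>i\<in>UNIV. (1 - t) * f i (x $ i) + t * f i (y $ i))"
      using convex_onD[OF f, of t] t by (intro sum_mono) simp
    also have "\<dots> = (1 - t) * ?F x + t * ?F y"
      by (simp only: sum.distrib sum_distrib_left)
    finally show "?F ((1 - t) *\<^sub>R x + t *\<^sub>R y) \<le> (1 - t) * ?F x + t * ?F y" .
  qed
  obtain lam where lam: "\<And>x. x \<in> ?X \<Longrightarrow> ?F xs + lam \<bullet> (?T x - ?b) \<le> ?F x"
  proof (rule lagrange_multiplier_rel_interior[OF T X F x0 xsX xsT])
    show "?F xs \<le> ?F x" if "x \<in> ?X" "?T x = ?b" for x by (rule xsmin[OF that])
  qed (rule that)
  have "f i (xs $ i) + lam \<bullet> (v - xs $ i) \<le> f i v" if v: "v \<in> \<Omega> i" for i v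
  proof -
    define x where "x = (\<chi> j. if j = i then v else xs $ j)"
    have split: "(\<Sum>j\<in>UNIV. h j (x $ j)) = h i v + (\<Sum>j\<in>UNIV - {i}. h j (xs $ j))"
      for h :: "'n \<Rightarrow> real^'p \<Rightarrow> 'z::comm_monoid_add"
      by (subst sum.remove[of _ i]) (auto simp: x_def intro!: sum.cong)
    have split': "(\<Sum>j\<in>UNIV. h j (xs $ j)) = h i (xs $ i) + (\<Sum>j\<in>UNIV - {i}. h j (xs $ j))"
      for h :: "'n \<Rightarrow> real^'p \<Rightarrow> 'z::comm_monoid_add"
      by (rule sum.remove) auto
    have "x \<in> ?X" using v xsX by (simp add: x_def)
    from lam[OF this] show ?thesis
      unfolding xsT[symmetric] split[of "\<lambda>_ u. u"] split'[of "\<lambda>_ u. u"] split[of f] split'[of f]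
      by simp
  qed
  with xsX show thesis by (intro that[of lam]) (simp add: is_subgradient_h_fun_iff)
qed

section \<open>The factor U of the mixing matrix\<close>

lemma U_times_diff: "U_times U (s - t) = (\<lambda>l. U_times U s l - U_times U t l)"
  by (simp add: fun_eq_iff U_times_def sum_subtractf scaleR_diff_right)

lemma Ut_times_diff: "Ut_times U (\<lambda>l. q l - q' l) = Ut_times U q - Ut_times U q'"
  by (simp add: Ut_times_def vec_eq_iff sum_subtractf scaleR_diff_right)

lemma Ut_times_add: "Ut_times U (\<lambda>l. q l + q' l) = Ut_times U q + Ut_times U q'"
  by (simp add: Ut_times_def vec_eq_iff sum.distrib scaleR_add_right)

text \<open>
  Both sides are the trace inner product: \<open>U\<^sup>T\<close> is the adjoint of \<open>U\<close>. Matrices with \<open>n - 1\<close>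
  rows have no type of their own here, so their inner product is the explicit sum.
\<close>
lemma U_times_adjoint:
  fixes s :: "real^'p::finite^'n::finite"
  shows "(\<Sum>l<CARD('n) - 1. U_times U s l \<bullet> q l) = s \<bullet> Ut_times U q"
proof -
  have "(\<Sum>l<CARD('n) - 1. U_times U s l \<bullet> q l)
      = (\<Sum>l<CARD('n) - 1. \<Sum>i\<in>UNIV. U l $ i * (s $ i \<bullet> q l))"
    by (simp add: U_times_def inner_sum_left)
  also have "\<dots> = (\<Sum>i\<in>UNIV. \<Sum>l<CARD('n) - 1. U l $ i * (s $ i \<bullet> q l))"
    by (rule sum.swap)
  also have "\<dots> = s \<bullet> Ut_times U q"
    by (simp add: Ut_times_def inner_vec_def[of s] inner_sum_right)
  finally show ?thesis .
qed

text \<open>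
  The null space of \<open>U\<close> consists of the constant vectors, so \<open>U g = 0\<close> says that all rows of
  \<open>g\<close> agree. The condition is checked one column of \<open>g\<close> at a time.
\<close>
lemma U_times_eq_0_iff:
  fixes g :: "real^'p::finite^'n::finite"
  assumes "null_space_U U = range (\<lambda>a. vec a)"
  shows "(\<forall>l<CARD('n) - 1. U_times U g l = 0) \<longleftrightarrow> (\<exists>a. \<forall>i. g $ i = a)"
proof
  assume 0: "\<forall>l<CARD('n) - 1. U_times U g l = 0"
  have "g $ i $ u = g $ j $ u" for i j u
  proof -
    have "U l \<bullet> column u g = 0" if "l < CARD('n) - 1" for l
    proof -
      have "U l \<bullet> column u g = U_times U g l $ u"
        by (simp add: U_times_def inner_vec_def column_def)
      then show ?thesis using 0 that by simp
    qed
    then have "column u g \<in> range (\<lambda>a. vec a)"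
      using assms by (auto simp: null_space_U_def)
    then obtain a where "column u g = vec a" by auto
    then have "column u g $ i = a" "column u g $ j = a" by auto
    then show ?thesis by (simp add: column_def)
  qed
  then have "\<forall>i. g $ i = g $ undefined" by (simp add: vec_eq_iff)
  then show "\<exists>a. \<forall>i. g $ i = a" by blast
next
  assume "\<exists>a. \<forall>i. g $ i = a"
  then obtain a where a: "\<And>i. g $ i = a" by blast
  have "(vec 1 :: real^'n) \<in> null_space_U U" unfolding assms by (rule rangeI)
  then have "(\<Sum>i\<in>UNIV. U l $ i) = 0" if "l < CARD('n) - 1" for l
    using that by (simp add: null_space_U_def inner_vec_def)
  then show "\<forall>l<CARD('n) - 1. U_times U g l = 0"
    by (simp add: U_times_def a scaleR_sum_left[symmetric])
qed

lemma sum_Ut_times: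
  assumes "null_space_U U = range (\<lambda>a. vec a)"
  shows "(\<Sum>i\<in>UNIV. (Ut_times U q :: real^'p::finite^'n::finite) $ i) = 0"
proof -
  let ?w = "Ut_times U q :: real^'p^'n"
  have "a \<bullet> (\<Sum>i\<in>UNIV. ?w $ i) = 0" for a
  proof -
    let ?g = "(\<chi> i. a) :: real^'p^'n"
    have "\<forall>l<CARD('n) - 1. U_times U ?g l = 0"
      using U_times_eq_0_iff[OF assms, of ?g] by simp
    then have "?g \<bullet> ?w = 0"
      using U_times_adjoint[of U ?g q] by simp
    then show ?thesis by (simp add: inner_vec_def[of ?g] inner_sum_right)
  qed
  then show ?thesis using inner_eq_zero_iff by blast
qed

text \<open>
  The range of \<open>U\<^sup>T\<close> is the orthogonal complement of the null space of \<open>U\<close>, that is, of the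
  constant vectors. For each column this is the double complement theorem applied to the
  row space \<open>S\<close> of \<open>U\<close>.
\<close>
lemma Ut_times_surj_sum_zero:
  fixes w :: "real^'p::finite^'n::finite"
  assumes N: "null_space_U U = range (\<lambda>a. vec a)" and w: "(\<Sum>i\<in>UNIV. w $ i) = 0"
  obtains q where "Ut_times U q = w"
proof -
  define S where "S = range (\<lambda>a. \<Sum>l<CARD('n) - 1. a l *\<^sub>R U l)"
  have S: "subspace S"
  proof (rule subspaceI)
    show "0 \<in> S" unfolding S_def by (rule range_eqI[of _ _ "\<lambda>_. 0"]) simp
  next
    fix x y assume "x \<in> S" "y \<in> S"
    then obtain a b where "x = (\<Sum>l<CARD('n) - 1. a l *\<^sub>R U l)" "y = (\<Sum>l<CARD('n) - 1. b l *\<^sub>R U l)"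
      unfolding S_def by blast
    then show "x + y \<in> S" unfolding S_def
      by (intro range_eqI[of _ _ "\<lambda>l. a l + b l"]) (simp add: sum.distrib scaleR_add_left)
  next
    fix t x assume "x \<in> S"
    then obtain a where "x = (\<Sum>l<CARD('n) - 1. a l *\<^sub>R U l)"
      unfolding S_def by blast
    then show "t *\<^sub>R x \<in> S" unfolding S_def
      by (intro range_eqI[of _ _ "\<lambda>l. t * a l"]) (simp add: scaleR_sum_right)
  qed
  have US: "U l \<in> S" if "l < CARD('n) - 1" for l
  proof -
    have "(\<Sum>m<CARD('n) - 1. (if m = l then 1 else 0) *\<^sub>R U m)
        = (\<Sum>m<CARD('n) - 1. if m = l then U m else 0)"
      by (intro sum.cong) auto
    also have "\<dots> = U l" using that by simp
    finally show ?thesis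
      unfolding S_def by (intro range_eqI[of _ _ "\<lambda>m. if m = l then 1 else 0"]) simp
  qed
  have "column u w \<in> S" for u
  proof -
    have "x \<bullet> column u w = 0" if x: "x \<in> orthogonal_comp S" for x
    proof -
      have "x \<in> null_space_U U"
        using x US by (auto simp: null_space_U_def orthogonal_comp_def orthogonal_def)
      then obtain a where "x = vec a" using N by auto
      then have "x \<bullet> column u w = a * (\<Sum>i\<in>UNIV. w $ i) $ u"
        by (simp add: inner_vec_def column_def sum_distrib_left)
      then show ?thesis using w by simp
    qed
    then have "column u w \<in> orthogonal_comp (orthogonal_comp S)"
      by (simp add: orthogonal_comp_def orthogonal_def)
    then show ?thesis by (simp add: orthogonal_comp_self[OF S])
  qed
  then have "\<forall>u. \<exists>a. column u w = (\<Sum>l<CARD('n) - 1. a l *\<^sub>R U l)"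
    by (auto simp: S_def)
  then obtain a where a: "\<And>u. column u w = (\<Sum>l<CARD('n) - 1. a u l *\<^sub>R U l)" by metis
  have "Ut_times U (\<lambda>l. \<chi> u. a u l) $ i $ u = column u w $ i" for i u
    by (simp add: a Ut_times_def mult.commute)
  then have "Ut_times U (\<lambda>l. \<chi> u. a u l) = w"
    by (simp add: vec_eq_iff column_def)
  then show thesis by (rule that)
qed

text \<open>
  The rows of \<open>U\<close> are linearly independent, so there is a dual family \<open>D\<close> with
  \<open>D l \<bullet> U m = \<delta>\<^sub>l\<^sub>m\<close>, and it recovers \<open>q\<close> from \<open>U\<^sup>T q\<close>. This transfers convergence from
  \<open>U\<^sup>T q\<^sup>k\<close>, where bounded sequences have convergent subsequences, back to \<open>q\<^sup>k\<close>.
\<close>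
lemma Ut_times_left_inverse:
  fixes U :: "nat \<Rightarrow> real^'n::finite"
  assumes "full_row_rank U"
  obtains D :: "nat \<Rightarrow> real^'n" where
    "\<And>(q :: nat \<Rightarrow> real^'p::finite) l. l < CARD('n) - 1 \<Longrightarrow> U_times D (Ut_times U q) l = q l"
proof -
  let ?I = "{..<CARD('n) - 1}"
  have dim: "dim (U ` ?I) = card ?I" using assms by (simp add: full_row_rank_def)
  have card: "card (U ` ?I) = card ?I"
    using dim_le_card'[of "U ` ?I"] dim card_image_le[of ?I U] by simp
  have inj: "inj_on U ?I" using card by (intro eq_card_imp_inj_on) auto
  have ind: "independent (U ` ?I)"
    using card_eq_dim[of "U ` ?I" "U ` ?I"] card dim by (simp add: span_superset)
  have "\<exists>d. \<forall>m\<in>?I. d \<bullet> U m = (if m = l then 1 else 0)" if l: "l \<in> ?I" for l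
  proof -
    obtain \<phi> :: "real^'n \<Rightarrow> real" where \<phi>: "linear \<phi>"
        "\<And>v. v \<in> U ` ?I \<Longrightarrow> \<phi> v = (if v = U l then 1 else 0)"
      using linear_independent_extend[OF ind, of "\<lambda>v. if v = U l then 1 else 0"] by blast
    have "adjoint \<phi> 1 \<bullet> v = \<phi> v" for v
      using adjoint_works[OF \<phi>(1), of v 1] by (simp add: inner_commute)
    then show ?thesis using \<phi>(2) inj l
      by (intro exI[of _ "adjoint \<phi> 1"]) (auto dest: inj_onD)
  qed
  then obtain D where D: "\<And>l m. l \<in> ?I \<Longrightarrow> m \<in> ?I \<Longrightarrow> D l \<bullet> U m = (if m = l then 1 else 0)"
    by metis
  show thesis
  proof (rule that)
    fix q :: "nat \<Rightarrow> real^'p" and l assume l: "l < CARD('n) - 1"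
    have "U_times D (Ut_times U q) l = (\<Sum>i\<in>UNIV. \<Sum>m\<in>?I. (D l $ i * U m $ i) *\<^sub>R q m)"
      by (simp add: U_times_def Ut_times_def scaleR_sum_right)
    also have "\<dots> = (\<Sum>m\<in>?I. (D l \<bullet> U m) *\<^sub>R q m)"
      by (subst sum.swap) (simp add: inner_vec_def scaleR_sum_left)
    also have "\<dots> = (\<Sum>m\<in>?I. if m = l then q m else 0)"
      using l by (intro sum.cong) (auto simp: D)
    also have "\<dots> = q l" using l by simp
    finally show "U_times D (Ut_times U q) l = q l" .
  qed
qed

section \<open>The metric of the algorithm\<close>

definition mat_times :: "real^'n^'n \<Rightarrow> real^'p^'n \<Rightarrow> real^'p^'n" where
  "mat_times A s = (\<chi> i. \<Sum>j\<in>UNIV. A $ i $ j *\<^sub>R s $ j)"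

lemma linear_mat_times: "linear (mat_times A)"
  by (rule linearI)
    (simp_all add: mat_times_def vec_eq_iff sum.distrib scaleR_sum_right algebra_simps sum_distrib_left)

lemma mat_times_symmetric:
  fixes s t :: "real^'p::finite^'n::finite"
  assumes "\<And>i j. A $ i $ j = A $ j $ i"
  shows "s \<bullet> mat_times A t = t \<bullet> mat_times A s"
proof -
  have "s \<bullet> mat_times A t = (\<Sum>i\<in>UNIV. \<Sum>j\<in>UNIV. A $ i $ j * (s $ i \<bullet> t $ j))"
    by (simp add: mat_times_def inner_vec_def[of s] inner_sum_right)
  also have "\<dots> = (\<Sum>j\<in>UNIV. \<Sum>i\<in>UNIV. A $ i $ j * (s $ i \<bullet> t $ j))"
    by (rule sum.swap)
  also have "\<dots> = t \<bullet> mat_times A s"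
    by (simp add: mat_times_def inner_vec_def[of t] inner_sum_right assms inner_commute)
  finally show ?thesis .
qed

lemma mat_times_gram_U: "mat_times (gram_U U) s = Ut_times U (U_times U s)"
proof -
  have "(\<Sum>j\<in>UNIV. \<Sum>l<n. (U l $ i * U l $ j) *\<^sub>R s $ j)
      = (\<Sum>l<n. \<Sum>j\<in>UNIV. (U l $ i * U l $ j) *\<^sub>R s $ j)" for i n
    by (rule sum.swap)
  then show ?thesis
    by (simp add: mat_times_def gram_U_def Ut_times_def U_times_def scaleR_sum_right scaleR_sum_left)
qed

lemma mat_times_preconditioner:
  "mat_times (diag_mat \<beta> - c *\<^sub>R gram_U U) s
    = (\<chi> i. \<beta> i *\<^sub>R s $ i) - c *\<^sub>R Ut_times U (U_times U s)"
proof -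
  have "(\<Sum>j\<in>UNIV. (if i = j then \<beta> i else 0) *\<^sub>R s $ j) = \<beta> i *\<^sub>R s $ i" for i
    by (subst sum.remove[of _ i]) auto
  then have "mat_times (diag_mat \<beta>) s = (\<chi> i. \<beta> i *\<^sub>R s $ i)"
    by (simp add: mat_times_def diag_mat_def)
  moreover have "mat_times (diag_mat \<beta> - c *\<^sub>R gram_U U) s
      = mat_times (diag_mat \<beta>) s - c *\<^sub>R mat_times (gram_U U) s"
    by (simp add: mat_times_def vec_eq_iff sum_subtractf scaleR_sum_right sum_distrib_left algebra_simps)
  ultimately show ?thesis by (simp add: mat_times_gram_U)
qed

text \<open>
  The quadratic form attains a positive minimum on the unit sphere of \<open>\<real>\<^sup>n\<close>. The bound for
  matrices \<open>s\<close> is the sum of the bounds for their columns.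
\<close>
lemma pos_def_coercive:
  fixes P :: "real^'n::finite^'n"
  assumes "pos_def P"
  obtains m where "m > 0" "\<And>s :: real^'p::finite^'n. m * (norm s)\<^sup>2 \<le> s \<bullet> mat_times P s"
proof -
  let ?\<Phi> = "\<lambda>v :: real^'n. v \<bullet> (P *v v)"
  have pos: "?\<Phi> v > 0" if "v \<noteq> 0" for v
  proof -
    have "\<exists>a\<in>UNIV. v $ a \<noteq> 0" using that by (auto simp: vec_eq_iff)
    then have "0 < (\<Sum>a\<in>UNIV. \<Sum>b\<in>UNIV. v $ a * P $ a $ b * v $ b)"
      using assms by (simp add: pos_def_def pos_def_on_def)
    then show ?thesis
      by (simp add: inner_vec_def matrix_vector_mult_def sum_distrib_left mult.assoc)
  qed
  have "continuous_on (sphere 0 1) ?\<Phi>"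
    by (intro continuous_intros matrix_vector_mult_linear_continuous_on)
  moreover have "sphere (0 :: real^'n) 1 \<noteq> {}" by simp
  ultimately have "\<exists>v0\<in>sphere 0 1. \<forall>v\<in>sphere 0 1. ?\<Phi> v0 \<le> ?\<Phi> v"
    by (intro continuous_attains_inf compact_sphere)
  then obtain v0 where v0: "v0 \<in> sphere 0 1" "\<And>v. v \<in> sphere 0 1 \<Longrightarrow> ?\<Phi> v0 \<le> ?\<Phi> v"
    by (elim bexE) (rule that, auto)
  let ?m = "?\<Phi> v0"
  have low: "?m * (norm v)\<^sup>2 \<le> ?\<Phi> v" for v
  proof (cases "v = 0")
    case False
    let ?u = "(1 / norm v) *\<^sub>R v"
    have "?m \<le> ?\<Phi> ?u" using False by (intro v0) simp
    also have "?\<Phi> ?u = ?\<Phi> v / (norm v)\<^sup>2"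
      by (simp only: matrix_vector_mult_scaleR inner_scaleR_left inner_scaleR_right)
        (simp add: power2_eq_square)
    finally show ?thesis using False by (simp add: field_simps)
  qed simp
  show thesis
  proof
    show "?m > 0" using v0(1) by (intro pos) auto
    fix s :: "real^'p^'n"
    have "(norm s)\<^sup>2 = (\<Sum>i\<in>UNIV. \<Sum>u\<in>UNIV. s $ i $ u * s $ i $ u)"
      by (simp add: power2_norm_eq_inner inner_vec_def)
    also have "\<dots> = (\<Sum>u\<in>UNIV. (norm (column u s))\<^sup>2)"
      by (subst sum.swap) (simp add: power2_norm_eq_inner inner_vec_def column_def)
    finally have "?m * (norm s)\<^sup>2 = (\<Sum>u\<in>UNIV. ?m * (norm (column u s))\<^sup>2)"
      by (simp only: sum_distrib_left)
    also have "\<dots> \<le> (\<Sum>u\<in>UNIV. ?\<Phi> (column u s))"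
      by (intro sum_mono low)
    also have "\<dots> = (\<Sum>i\<in>UNIV. \<Sum>u\<in>UNIV. s $ i $ u * (\<Sum>j\<in>UNIV. P $ i $ j * s $ j $ u))"
      by (subst sum.swap) (simp add: inner_vec_def matrix_vector_mult_def column_def)
    also have "\<dots> = s \<bullet> mat_times P s"
      by (simp add: inner_vec_def mat_times_def)
    finally show "?m * (norm s)\<^sup>2 \<le> s \<bullet> mat_times P s" .
  qed
qed

text \<open>
  For \<open>P = B - c L\<close> this is the squared norm of the stacked matrix \<open>(q, s)\<close> that the block
  matrix induces; see \<open>wnorm_stack_squared\<close>.
\<close>
definition energy :: "real \<Rightarrow> real^'n^'n \<Rightarrow> (nat \<Rightarrow> real^'p) \<Rightarrow> real^'p^'n \<Rightarrow> real" where
  "energy c P q s = c * (\<Sum>l<CARD('n) - 1. q l \<bullet> q l) + s \<bullet> mat_times P s"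

lemma energy_add:
  fixes s s' :: "real^'p::finite^'n::finite"
  assumes "\<And>i j. P $ i $ j = P $ j $ i"
  shows "energy c P (\<lambda>l. q l + q' l) (s + s') = energy c P q s + energy c P q' s' +
    2 * (c * (\<Sum>l<CARD('n) - 1. q l \<bullet> q' l) + s' \<bullet> mat_times P s)"
proof -
  have "(\<Sum>l<CARD('n) - 1. (q l + q' l) \<bullet> (q l + q' l))
      = (\<Sum>l<CARD('n) - 1. q l \<bullet> q l) + (\<Sum>l<CARD('n) - 1. q' l \<bullet> q' l)
        + 2 * (\<Sum>l<CARD('n) - 1. q l \<bullet> q' l)"
    by (simp add: inner_add_left inner_add_right inner_commute sum.distrib sum_distrib_left)
  moreover have "(s + s') \<bullet> mat_times P (s + s')
      = s \<bullet> mat_times P s + s' \<bullet> mat_times P s' + 2 * (s' \<bullet> mat_times P s)"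
    using mat_times_symmetric[OF assms, of s s']
    by (simp add: linear_add[OF linear_mat_times] inner_add_left inner_add_right)
  ultimately show ?thesis by (simp add: energy_def algebra_simps)
qed

lemma sum_block_M:
  fixes v w :: "nat + 'n::finite \<Rightarrow> 'a::real_inner"
  shows "(\<Sum>a\<in>block_idx. \<Sum>b\<in>block_idx. block_M c B L a b * (v a \<bullet> w b))
    = c * (\<Sum>l<CARD('n) - 1. v (Inl l) \<bullet> w (Inl l))
      + (\<Sum>i\<in>UNIV. \<Sum>j\<in>UNIV. (B - c *\<^sub>R L) $ i $ j * (v (Inr i) \<bullet> w (Inr j)))"
proof -
  have "(\<Sum>m<CARD('n) - 1. (if l = m then c else 0) * (v (Inl l) \<bullet> w (Inl m)))
      = (if l < CARD('n) - 1 then c * (v (Inl l) \<bullet> w (Inl l)) else 0)" for l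
  proof -
    have "(\<Sum>m<CARD('n) - 1. (if l = m then c else 0) * (v (Inl l) \<bullet> w (Inl m)))
        = (\<Sum>m<CARD('n) - 1. if l = m then c * (v (Inl l) \<bullet> w (Inl m)) else 0)"
      by (intro sum.cong) auto
    then show ?thesis by simp
  qed
  then show ?thesis
    by (simp add: block_idx_def sum.Plus sum_distrib_left)
qed

lemma pos_def_on_block_M:
  fixes B L :: "real^'n::finite^'n"
  assumes "c > 0" and P: "pos_def (B - c *\<^sub>R L)"
  shows "pos_def_on block_idx (block_M c B L)"
  unfolding pos_def_on_def
proof (intro conjI ballI allI impI)
  fix a b :: "nat + 'n"
  show "block_M c B L a b = block_M c B L b a"
    using P by (cases a; cases b) (auto simp: pos_def_def pos_def_on_def)
next
  fix v :: "nat + 'n \<Rightarrow> real" assume nz: "\<exists>a\<in>block_idx. v a \<noteq> 0"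
  let ?q = "\<Sum>l<CARD('n) - 1. v (Inl l) * v (Inl l)"
  let ?s = "\<Sum>i\<in>UNIV. \<Sum>j\<in>UNIV. v (Inr i) * (B - c *\<^sub>R L) $ i $ j * v (Inr j)"
  have eq: "(\<Sum>a\<in>block_idx. \<Sum>b\<in>block_idx. v a * block_M c B L a b * v b) = c * ?q + ?s"
    using sum_block_M[of c B L v v] by (simp only: inner_real_def mult_ac)
  have spos: "0 < ?s" if "\<exists>i. v (Inr i) \<noteq> 0"
    using P that by (simp add: pos_def_def pos_def_on_def)
  have q0: "0 \<le> ?q" by (intro sum_nonneg) simp
  show "0 < (\<Sum>a\<in>block_idx. \<Sum>b\<in>block_idx. v a * block_M c B L a b * v b)"
  proof (cases "\<exists>i. v (Inr i) \<noteq> 0")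
    case True
    then show ?thesis unfolding eq using spos q0 \<open>c > 0\<close> by (intro add_nonneg_pos) auto
  next
    case False
    then obtain l where "l < CARD('n) - 1" "v (Inl l) \<noteq> 0"
      using nz by (auto simp: block_idx_def)
    then have "0 < ?q" by (intro sum_pos2[of _ l]) (auto simp: zero_less_mult_iff)
    then show ?thesis unfolding eq using False \<open>c > 0\<close> by simp
  qed
qed

text \<open>
  Nonnegativity is assumed because the square root in \<open>wnorm\<close> is only undone by squaring when
  the trace is nonnegative.
\<close>
lemma wnorm_stack_squared:
  fixes s :: "real^'p::finite^'n::finite"
  assumes "0 \<le> energy c (B - c *\<^sub>R L) q s"
  shows "(wnorm block_idx (block_M c B L) (stack q s))\<^sup>2 = energy c (B - c *\<^sub>R L) q s"
proof -
  let ?z = "stack q s" and ?M = "block_M c B L" and ?I = "block_idx :: (nat + 'n) set"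
  have "trace ((\<chi> u v. \<Sum>a\<in>?I. \<Sum>b\<in>?I. ?z a $ u * ?M a b * ?z b $ v) :: real^'p^'p)
      = (\<Sum>u\<in>UNIV. \<Sum>a\<in>?I. \<Sum>b\<in>?I. ?z a $ u * ?M a b * ?z b $ u)"
    by (simp add: trace_def)
  also have "\<dots> = (\<Sum>a\<in>?I. \<Sum>b\<in>?I. \<Sum>u\<in>UNIV. ?z a $ u * ?M a b * ?z b $ u)"
    by (subst sum.swap, intro sum.cong refl, rule sum.swap)
  also have "\<dots> = (\<Sum>a\<in>?I. \<Sum>b\<in>?I. ?M a b * (?z a \<bullet> ?z b))"
    by (simp add: inner_vec_def sum_distrib_left mult_ac)
  also have "\<dots> = energy c (B - c *\<^sub>R L) q s"
    by (simp add: sum_block_M energy_def stack_def mat_times_def inner_vec_def[of s] inner_sum_right)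
  finally show ?thesis using assms by (simp add: wnorm_def)
qed

section \<open>Optimality\<close>

text \<open>
  Sufficiency of the optimality conditions. The rows of \<open>g\<close> agree, so summing the subgradient
  inequalities leaves a linear term in the total allocation, which is the same for all feasible
  points. The total of \<open>xs\<close> is right because the rows of \<open>U\<^sup>T q\<close> sum to zero.
\<close>
lemma is_z_star_imp_solution:
  fixes xs :: "real^'p::finite^'n::finite"
  assumes N: "null_space_U U = range (\<lambda>a. vec a)" and z: "is_z_star f \<Omega> r U c xs zs"
  shows "xs \<in> solutions f r \<Omega>"
proof -
  obtain q g where sub: "\<And>i. is_subgradient (h_fun (f i) (\<Omega> i)) (xs $ i) (g $ i)"
    and dual: "xs - r + c *\<^sub>R Ut_times U q = 0" and g0: "\<forall>l<CARD('n) - 1. U_times U g l = 0"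
    using z by (auto simp: is_z_star_def)
  obtain a where a: "\<And>i. g $ i = a"
    using U_times_eq_0_iff[OF N, of g] g0 by auto
  have "xs - r = - (c *\<^sub>R Ut_times U q)" using dual by (simp add: eq_neg_iff_add_eq_0)
  then have "(\<Sum>i\<in>UNIV. (xs - r) $ i) = - (c *\<^sub>R (\<Sum>i\<in>UNIV. (Ut_times U q :: real^'p^'n) $ i))"
    by (simp add: sum_negf scaleR_sum_right)
  then have balance: "(\<Sum>i\<in>UNIV. xs $ i) = (\<Sum>i\<in>UNIV. r $ i)"
    by (simp add: sum_Ut_times[OF N] sum_subtractf)
  have "(\<Sum>i\<in>UNIV. f i (xs $ i)) \<le> (\<Sum>i\<in>UNIV. f i (x $ i))" if x: "x \<in> feasible r \<Omega>" for x
  proof -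
    have "(\<Sum>i\<in>UNIV. f i (xs $ i) + a \<bullet> (x $ i - xs $ i)) \<le> (\<Sum>i\<in>UNIV. f i (x $ i))"
      using sub x by (intro sum_mono) (auto simp: is_subgradient_h_fun_iff a feasible_def)
    moreover have "(\<Sum>i\<in>UNIV. a \<bullet> (x $ i - xs $ i)) = 0"
      using x balance
      by (simp add: feasible_def sum_subtractf inner_sum_right[symmetric])
    ultimately show ?thesis by (simp add: sum.distrib)
  qed
  moreover have "xs \<in> feasible r \<Omega>"
    using sub balance by (auto simp: feasible_def is_subgradient_h_fun_iff sum_subtractf)
  ultimately show ?thesis by (simp add: solutions_def is_arg_min_linorder)
qed

text \<open>
  Necessity of the optimality conditions, which is where the Slater condition is used: the
  multiplier, repeated in every row, is the required matrix of subgradients.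
\<close>
lemma solution_imp_is_z_star:
  fixes f :: "'n::finite \<Rightarrow> real^'p::finite \<Rightarrow> real"
  assumes f: "\<And>i. convex_on UNIV (f i)" and \<Omega>: "\<And>i. convex (\<Omega> i)"
    and N: "null_space_U U = range (\<lambda>a. vec a)" and "c > 0"
    and xs: "xs \<in> solutions f r \<Omega>" and sl: "slater r \<Omega>"
  obtains zs where "is_z_star f \<Omega> r U c xs zs"
proof -
  obtain lam where lam: "\<And>i. is_subgradient (h_fun (f i) (\<Omega> i)) (xs $ i) lam"
    by (rule solution_common_subgradient[OF f \<Omega> xs sl]) (rule that)
  let ?g = "(\<chi> i. lam) :: real^'p^'n"
  have "(\<Sum>i\<in>UNIV. ((1 / c) *\<^sub>R (r - xs)) $ i) = 0"
    using xs by (simp add: solutions_def is_arg_min_linorder feasible_def sum_subtractf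
        scaleR_sum_right[symmetric])
  then obtain q where "Ut_times U q = (1 / c) *\<^sub>R (r - xs)"
    using Ut_times_surj_sum_zero[OF N] by metis
  then have "xs - r + c *\<^sub>R Ut_times U q = 0" using \<open>c > 0\<close> by simp
  moreover have "\<forall>l<CARD('n) - 1. U_times U ?g l = 0"
    using U_times_eq_0_iff[OF N, of ?g] by simp
  ultimately have "is_z_star f \<Omega> r U c xs (stack q ?g)"
    using lam unfolding is_z_star_def by (intro exI[of _ q] exI[of _ ?g]) simp
  then show thesis by (rule that)
qed

section \<open>The iteration\<close>

lemma mirror_p_extra_y_step:
  assumes "mirror_p_extra f \<Omega> r E L \<beta> c x s y" and "graph_compatible E L" and "L = gram_U U"
  shows "y (Suc k) = y k + Ut_times U (U_times U (s k))"
proof -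
  have "(\<Sum>j\<in>neighbors E i \<union> {i}. L $ i $ j *\<^sub>R s k $ j) = mat_times L (s k) $ i" for i
  proof -
    have "(\<Sum>j\<in>neighbors E i \<union> {i}. L $ i $ j *\<^sub>R s k $ j) = (\<Sum>j\<in>UNIV. L $ i $ j *\<^sub>R s k $ j)"
      using assms(2) by (intro sum.mono_neutral_left) (auto simp: neighbors_def graph_compatible_def)
    then show ?thesis by (simp add: mat_times_def)
  qed
  then show ?thesis
    using assms(1) unfolding mat_times_gram_U[symmetric] assms(3)[symmetric]
    by (simp add: mirror_p_extra_def vec_eq_iff)
qed

text \<open>
  The agents never form \<open>q\<^sup>k\<close>; they propagate \<open>y\<^sup>k = U\<^sup>T q\<^sup>k\<close>, which only needs communication
  along edges because \<open>U\<^sup>T U = L\<close> is compatible with the graph.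
\<close>
lemma mirror_p_extra_y_eq:
  assumes "mirror_p_extra f \<Omega> r E L \<beta> c x s y" and "graph_compatible E L" and "L = gram_U U"
  shows "y k = Ut_times U (q_seq U s k)"
proof (induction k)
  case 0
  then show ?case using assms(1) by (simp add: mirror_p_extra_def vec_eq_iff Ut_times_def)
next
  case (Suc k)
  then show ?case by (simp add: mirror_p_extra_y_step[OF assms] Ut_times_add)
qed

lemma mirror_p_extra_subgradient:
  fixes f :: "'n::finite \<Rightarrow> real^'p::finite \<Rightarrow> real"
  assumes m: "mirror_p_extra f \<Omega> r E L \<beta> c x s y"
    and f: "convex_on UNIV (f i)" and \<Omega>: "convex (\<Omega> i)" and \<beta>: "\<beta> i > 0"
  shows "is_subgradient (h_fun (f i) (\<Omega> i)) (x (Suc k) $ i) (s (Suc k) $ i)"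
proof -
  define w where "w = r $ i - (2 * c) *\<^sub>R y (Suc k) $ i + c *\<^sub>R y k $ i"
  have w: "v - r $ i + (2 * c) *\<^sub>R y (Suc k) $ i - c *\<^sub>R y k $ i = v - w" for v
    by (simp add: w_def)
  have "is_arg_min (\<lambda>v. f i v - s k $ i \<bullet> v + 1 / (2 * \<beta> i) * (norm (v - w))\<^sup>2)
      (\<lambda>v. v \<in> \<Omega> i) (x (Suc k) $ i)"
    and "s (Suc k) $ i = s k $ i - (1 / \<beta> i) *\<^sub>R (x (Suc k) $ i - w)"
    using m unfolding mirror_p_extra_def w[symmetric] by blast+
  then show ?thesis using prox_step_subgradient[OF f \<Omega> \<beta>] by simp
qed

text \<open>
  The algorithm is a proximal point iteration for the optimality conditions, preconditioned by
  \<open>B - c L\<close>: the extrapolation gives \<open>2 y\<^sup>k - y\<^sup>k\<^sup>-\<^sup>1 = y\<^sup>k + L s\<^sup>k = y\<^sup>k\<^sup>+\<^sup>1 + L (s\<^sup>k - s\<^sup>k\<^sup>+\<^sup>1)\<close>, and moving the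
  last term to the left makes the update implicit, with the residual at the new dual variable
  \<open>q\<^sup>k\<^sup>+\<^sup>1\<close> (at index \<open>k + 2\<close> of \<open>q_seq\<close>) on the right. Together with
  \<open>q\<^sup>k\<^sup>+\<^sup>1 - q\<^sup>k = U s\<^sup>k\<^sup>+\<^sup>1\<close> it describes the product of the block matrix with \<open>z\<^sup>k - z\<^sup>k\<^sup>+\<^sup>1\<close>.
\<close>
lemma mirror_p_extra_residual:
  fixes x s y :: "nat \<Rightarrow> real^'p::finite^'n::finite"
  assumes m: "mirror_p_extra f \<Omega> r E L \<beta> c x s y" and L: "graph_compatible E L" "L = gram_U U"
    and \<beta>: "\<And>i. \<beta> i > 0"
  shows "mat_times (diag_mat \<beta> - c *\<^sub>R L) (s k - s (Suc k))
    = x (Suc k) - r + c *\<^sub>R Ut_times U (q_seq U s (Suc (Suc k)))"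
proof -
  let ?A = "\<lambda>k. Ut_times U (U_times U (s k))"
  note ystep = mirror_p_extra_y_step[OF m L]
  have two: "(2 * c) *\<^sub>R v = c *\<^sub>R v + c *\<^sub>R v" for v :: "real^'p^'n"
    by (simp only: mult_2 scaleR_add_left)
  have "(\<chi> i. \<beta> i *\<^sub>R (s k - s (Suc k)) $ i)
      = x (Suc k) - r + (2 * c) *\<^sub>R y (Suc k) - c *\<^sub>R y k"
  proof -
    have "s k $ i - s (Suc k) $ i = (1 / \<beta> i) *\<^sub>R
        (x (Suc k) $ i - r $ i + (2 * c) *\<^sub>R y (Suc k) $ i - c *\<^sub>R y k $ i)" for i
      using m by (simp add: mirror_p_extra_def)
    then show ?thesis using \<beta>[THEN less_imp_neq] by (simp add: vec_eq_iff)
  qed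
  also have "\<dots> = x (Suc k) - r + c *\<^sub>R y (Suc (Suc k)) + c *\<^sub>R (?A k - ?A (Suc k))"
    unfolding ystep[of "Suc k"] two by (simp add: ystep[of k] algebra_simps)
  also have "?A k - ?A (Suc k) = Ut_times U (U_times U (s k - s (Suc k)))"
    by (simp add: U_times_diff Ut_times_diff)
  finally show ?thesis
    unfolding L(2) mat_times_preconditioner mirror_p_extra_y_eq[OF m L] by simp
qed

text \<open>
  Expand the squared norm of \<open>z\<^sup>0 - z\<^sup>* = (z\<^sup>0 - z\<^sup>1) + (z\<^sup>1 - z\<^sup>*)\<close>. In the cross term the
  contributions of \<open>q\<close> cancel by adjointness of \<open>U\<close> and \<open>U\<^sup>T\<close>, and what is left pairs the
  differences of points and of subgradients, so that monotonicity of subdifferentials applies.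
\<close>
lemma fejer_identity:
  fixes s0 s1 g x1 xs r :: "real^'p::finite^'n::finite"
  assumes sym: "\<And>i j. P $ i $ j = P $ j $ i"
    and res: "mat_times P (s0 - s1) = x1 - r + c *\<^sub>R Ut_times U q1"
    and q1: "\<And>l. q1 l = q0 l + U_times U s1 l"
    and xs: "xs - r + c *\<^sub>R Ut_times U q = 0" and g: "\<forall>l<CARD('n) - 1. U_times U g l = 0"
  shows "energy c P (\<lambda>l. q0 l - q1 l) (s0 - s1)
    = energy c P (\<lambda>l. q0 l - q l) (s0 - g) - energy c P (\<lambda>l. q1 l - q l) (s1 - g)
      - 2 * ((x1 - xs) \<bullet> (s1 - g))"
proof -
  have r: "r = xs + c *\<^sub>R Ut_times U q" using xs by (simp add: algebra_simps)
  have "(\<Sum>l<CARD('n) - 1. (q0 l - q1 l) \<bullet> (q1 l - q l))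
      = - (\<Sum>l<CARD('n) - 1. U_times U (s1 - g) l \<bullet> (q1 l - q l))"
    unfolding sum_negf[symmetric] using g by (intro sum.cong) (auto simp: q1 U_times_diff)
  also have "\<dots> = - ((s1 - g) \<bullet> (Ut_times U q1 - Ut_times U q))"
    by (simp only: U_times_adjoint Ut_times_diff)
  finally have cross: "(\<Sum>l<CARD('n) - 1. (q0 l - q1 l) \<bullet> (q1 l - q l))
      = - ((s1 - g) \<bullet> (Ut_times U q1 - Ut_times U q))" .
  have "mat_times P (s0 - s1) = (x1 - xs) + c *\<^sub>R (Ut_times U q1 - Ut_times U q)"
    unfolding res r by (simp add: algebra_simps)
  then have "c * (\<Sum>l<CARD('n) - 1. (q0 l - q1 l) \<bullet> (q1 l - q l)) + (s1 - g) \<bullet> mat_times P (s0 - s1)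
      = (x1 - xs) \<bullet> (s1 - g)"
    unfolding cross by (simp add: inner_add_right inner_commute)
  then show ?thesis
    using energy_add[OF sym, of c "\<lambda>l. q0 l - q1 l" "\<lambda>l. q1 l - q l" "s0 - s1" "s1 - g"]
    by simp
qed

section \<open>Convergence of the dual variables\<close>

lemma tendsto_U_times:
  fixes s :: "real^'p::finite^'n::finite"
  assumes "(t \<longlongrightarrow> s) F"
  shows "((\<lambda>k. U_times U (t k) l) \<longlongrightarrow> U_times U s l) F"
  unfolding U_times_def by (intro tendsto_intros assms)

lemma tendsto_Ut_times:
  assumes "\<And>l. l < CARD('n) - 1 \<Longrightarrow> ((\<lambda>k. w k l) \<longlongrightarrow> q l) F"
  shows "((\<lambda>k. Ut_times U (w k)) \<longlongrightarrow> (Ut_times U q :: real^'p::finite^'n::finite)) F"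
  unfolding Ut_times_def by (intro vec_tendstoI) (auto intro!: tendsto_intros assms)

lemma tendsto_mat_times:
  fixes s :: "real^'p::finite^'n::finite"
  assumes "(t \<longlongrightarrow> s) F"
  shows "((\<lambda>k. mat_times A (t k)) \<longlongrightarrow> mat_times A s) F"
  unfolding mat_times_def by (intro vec_tendstoI) (auto intro!: tendsto_intros assms)

lemma norm_Ut_times_le:
  assumes "\<And>l. l < CARD('n) - 1 \<Longrightarrow> norm (q l) \<le> K"
  shows "norm (Ut_times U q :: real^'p::finite^'n::finite)
    \<le> (\<Sum>i\<in>UNIV. \<Sum>l<CARD('n) - 1. \<bar>U l $ i\<bar> * K)"
proof -
  let ?w = "Ut_times U q :: real^'p^'n"
  have "norm ?w \<le> (\<Sum>i\<in>UNIV. norm (?w $ i))"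
    unfolding norm_vec_def[of ?w] by (rule L2_set_le_sum) simp
  also have "\<dots> \<le> (\<Sum>i\<in>UNIV. \<Sum>l<CARD('n) - 1. \<bar>U l $ i\<bar> * K)"
    unfolding Ut_times_def using assms
    by (intro sum_mono) (auto intro!: sum_norm_le mult_left_mono)
  finally show ?thesis .
qed

lemma energy_lower_bounds:
  fixes P :: "real^'n::finite^'n"
  assumes "c > 0" and "pos_def P"
  obtains m where "m > 0"
    "\<And>q (s :: real^'p::finite^'n). m * (norm s)\<^sup>2 \<le> energy c P q s"
    "\<And>q (s :: real^'p^'n) l. l < CARD('n) - 1 \<Longrightarrow> c * (norm (q l))\<^sup>2 \<le> energy c P q s"
proof -
  obtain m where m: "m > 0" "\<And>s :: real^'p^'n. m * (norm s)\<^sup>2 \<le> s \<bullet> mat_times P s"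
    by (rule pos_def_coercive[OF assms(2)]) (rule that)
  show thesis
  proof (rule that[OF m(1)])
    fix q and s :: "real^'p^'n"
    show "m * (norm s)\<^sup>2 \<le> energy c P q s"
      using m(2)[of s] \<open>c > 0\<close> by (simp add: energy_def sum_nonneg add_increasing)
    fix l assume "l < CARD('n) - 1"
    then have "q l \<bullet> q l \<le> (\<Sum>l<CARD('n) - 1. q l \<bullet> q l)"
      by (intro member_le_sum) auto
    then have "c * (norm (q l))\<^sup>2 \<le> c * (\<Sum>l<CARD('n) - 1. q l \<bullet> q l)"
      using \<open>c > 0\<close> by (simp add: power2_norm_eq_inner)
    moreover have "0 \<le> s \<bullet> mat_times P s"
      using m(2)[of s] mult_nonneg_nonneg[OF less_imp_le[OF m(1)] zero_le_power2[of "norm s"]]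
      by linarith
    ultimately show "c * (norm (q l))\<^sup>2 \<le> energy c P q s"
      by (simp add: energy_def)
  qed
qed

lemma energy_nonneg:
  fixes s :: "real^'p::finite^'n::finite"
  assumes "c > 0" and "pos_def P"
  shows "0 \<le> energy c P q s"
proof -
  obtain m where m: "m > 0" "\<And>q (s :: real^'p^'n). m * (norm s)\<^sup>2 \<le> energy c P q s"
    by (rule energy_lower_bounds[OF assms]) (rule that)
  have "0 \<le> m * (norm s)\<^sup>2" using m(1) by simp
  also have "\<dots> \<le> energy c P q s" by (rule m(2))
  finally show ?thesis .
qed

lemma norm_sq_tendsto_zeroD:
  fixes a :: "nat \<Rightarrow> 'a::real_normed_vector"
  assumes "m > 0" and "\<And>k. m * (norm (a k))\<^sup>2 \<le> W k" and "W \<longlonglongrightarrow> 0"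
  shows "a \<longlonglongrightarrow> 0"
proof -
  have W: "(\<lambda>k. W k / m) \<longlonglongrightarrow> 0" using tendsto_divide[OF assms(3) tendsto_const, of m] assms(1) by simp
  have "(norm (a k))\<^sup>2 \<le> W k / m" for k
    using assms(1) assms(2)[of k] by (simp add: field_simps)
  then have "\<forall>\<^sub>F k in sequentially. norm ((norm (a k))\<^sup>2) \<le> W k / m" by simp
  then have "(\<lambda>k. (norm (a k))\<^sup>2) \<longlonglongrightarrow> 0"
    using W by (rule Lim_null_comparison)
  then have "(\<lambda>k. sqrt ((norm (a k))\<^sup>2)) \<longlonglongrightarrow> sqrt 0" by (intro tendsto_intros)
  then show ?thesis by (simp add: tendsto_norm_zero_iff)
qed

lemma energy_tendsto_zeroD:
  fixes t :: "nat \<Rightarrow> real^'p::finite^'n::finite"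
  assumes "c > 0" and "pos_def P" and W: "(\<lambda>k. energy c P (w k) (t k)) \<longlonglongrightarrow> 0"
  shows "t \<longlonglongrightarrow> 0" and "\<And>l. l < CARD('n) - 1 \<Longrightarrow> (\<lambda>k. w k l) \<longlonglongrightarrow> 0"
proof -
  obtain m where m: "m > 0"
    "\<And>q (s :: real^'p^'n). m * (norm s)\<^sup>2 \<le> energy c P q s"
    "\<And>q (s :: real^'p^'n) l. l < CARD('n) - 1 \<Longrightarrow> c * (norm (q l))\<^sup>2 \<le> energy c P q s"
    by (rule energy_lower_bounds[OF assms(1,2)]) (rule that)
  show "t \<longlonglongrightarrow> 0" by (rule norm_sq_tendsto_zeroD[OF m(1,2) W])
  show "(\<lambda>k. w k l) \<longlonglongrightarrow> 0" if "l < CARD('n) - 1" for l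
    by (rule norm_sq_tendsto_zeroD[OF assms(1) m(3)[OF that] W])
qed

lemma tendsto_energy_zero:
  fixes t :: "nat \<Rightarrow> real^'p::finite^'n::finite"
  assumes "\<And>l. l < CARD('n) - 1 \<Longrightarrow> (\<lambda>k. w k l) \<longlonglongrightarrow> 0" and "t \<longlonglongrightarrow> 0"
  shows "(\<lambda>k. energy c P (w k) (t k)) \<longlonglongrightarrow> 0"
proof -
  have "(\<lambda>k. energy c P (w k) (t k))
      \<longlonglongrightarrow> c * (\<Sum>l<CARD('n) - 1. 0 \<bullet> (0 :: real^'p)) + (0 :: real^'p^'n) \<bullet> mat_times P 0"
    unfolding energy_def
    by (intro tendsto_add tendsto_mult_left tendsto_sum tendsto_inner tendsto_mat_times assms) auto
  then show ?thesis by simp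
qed

lemma decseq_subseq_tendsto_zero:
  fixes W :: "nat \<Rightarrow> real"
  assumes "\<And>k. 0 \<le> W k" and "\<And>k. W (Suc k) \<le> W k"
    and "strict_mono \<rho>" and sub: "(\<lambda>k. W (\<rho> k)) \<longlonglongrightarrow> 0"
  shows "W \<longlonglongrightarrow> 0"
proof -
  have "decseq W" using assms(2) by (rule decseq_SucI)
  then obtain w where w: "W \<longlonglongrightarrow> w" using decseq_convergent[of W 0] assms(1) by blast
  then have "(\<lambda>k. W (\<rho> k)) \<longlonglongrightarrow> w"
    using LIMSEQ_subseq_LIMSEQ[OF w assms(3)] by (simp add: o_def)
  then show ?thesis using w sub LIMSEQ_unique by blast
qed


text \<open>
  The argument of Opial. The distances to one point \<open>z\<^sup>*\<close> decrease, so the iterates are bounded and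
  successive differences vanish. Along a subsequence \<open>(U\<^sup>T q\<^sup>k, s\<^sup>k)\<close> converges; since the residuals
  vanish, the limit satisfies the optimality conditions. It may therefore take the role of \<open>z\<^sup>*\<close>:
  the distances to it decrease and vanish along the subsequence, hence vanish. Finally \<open>x\<^sup>k\<close>
  is an affine function of \<open>U\<^sup>T q\<^sup>k\<close> up to a vanishing residual.
\<close>
lemma mirror_p_extra_converges:
  fixes f :: "'n::finite \<Rightarrow> real^'p::finite \<Rightarrow> real"
  assumes f: "\<And>i. convex_on UNIV (f i)" and \<Omega>: "\<And>i. closed (\<Omega> i)"
    and N: "null_space_U U = range (\<lambda>a. vec a)" and rank: "full_row_rank U"
    and c: "c > 0" and P: "pos_def P"
    and sub: "\<And>k i. is_subgradient (h_fun (f i) (\<Omega> i)) (x (Suc k) $ i) (s (Suc k) $ i)"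
    and res: "\<And>k. mat_times P (s k - s (Suc k)) = x (Suc k) - r + c *\<^sub>R Ut_times U (q (Suc k))"
    and q: "\<And>k l. q (Suc k) l = q k l + U_times U (s (Suc k)) l"
    and z: "is_z_star f \<Omega> r U c xs zs"
  shows "\<exists>x'\<in>solutions f r \<Omega>. x \<longlonglongrightarrow> x'"
proof -
  let ?E = "energy c P" and ?I = "{..<CARD('n) - 1}"
  have sym: "P $ i $ j = P $ j $ i" for i j
    using P by (simp add: pos_def_def pos_def_on_def)
  note nonneg = energy_nonneg[OF c P]
  have fejer: "?E (\<lambda>l. q k l - q (Suc k) l) (s k - s (Suc k))
      \<le> ?E (\<lambda>l. q k l - q' l) (s k - g') - ?E (\<lambda>l. q (Suc k) l - q' l) (s (Suc k) - g')"
    if "\<And>i. is_subgradient (h_fun (f i) (\<Omega> i)) (x' $ i) (g' $ i)"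
      and "x' - r + c *\<^sub>R Ut_times U q' = 0" and "\<forall>l<CARD('n) - 1. U_times U g' l = 0"
    for k x' q' g'
  proof -
    have "0 \<le> (x (Suc k) - x') \<bullet> (s (Suc k) - g')"
      using subgradient_monotone[OF sub that(1)]
      by (simp add: inner_vec_def[of "x (Suc k) - x'"] sum_nonneg)
    then show ?thesis using fejer_identity[OF sym res q that(2,3)] by simp
  qed
  obtain q1 g1 where z1: "\<And>i. is_subgradient (h_fun (f i) (\<Omega> i)) (xs $ i) (g1 $ i)"
    "xs - r + c *\<^sub>R Ut_times U q1 = 0" "\<forall>l<CARD('n) - 1. U_times U g1 l = 0"
    using z by (auto simp: is_z_star_def)
  define V where "V k = ?E (\<lambda>l. q k l - q1 l) (s k - g1)" for k
  define \<Delta> where "\<Delta> k = ?E (\<lambda>l. q k l - q (Suc k) l) (s k - s (Suc k))" for k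
  have \<Delta>V: "\<Delta> k \<le> V k - V (Suc k)" for k
    unfolding \<Delta>_def V_def by (rule fejer[OF z1])
  have \<Delta>0: "0 \<le> \<Delta> k" and V0: "0 \<le> V k" for k
    by (simp_all add: \<Delta>_def V_def nonneg)
  have "V (Suc k) \<le> V k" for k using \<Delta>V[of k] \<Delta>0[of k] by linarith
  then have Vdec: "decseq V" by (rule decseq_SucI)
  have "\<Delta> \<longlonglongrightarrow> 0"
  proof -
    obtain v where v: "V \<longlonglongrightarrow> v" using decseq_convergent[OF Vdec] V0 by blast
    then have "(\<lambda>k. V k - V (Suc k)) \<longlonglongrightarrow> v - v"
      by (intro tendsto_diff LIMSEQ_Suc)
    then have "(\<lambda>k. V k - V (Suc k)) \<longlonglongrightarrow> 0" by simp
    moreover have "\<forall>\<^sub>F k in sequentially. norm (\<Delta> k) \<le> V k - V (Suc k)"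
      using \<Delta>V \<Delta>0 by simp
    ultimately show ?thesis by (rule Lim_null_comparison[rotated])
  qed
  note step0 = energy_tendsto_zeroD[OF c P this[unfolded \<Delta>_def]]

  obtain m where m: "m > 0" "\<And>q (s :: real^'p^'n). m * (norm s)\<^sup>2 \<le> ?E q s"
      "\<And>q (s :: real^'p^'n) l. l < CARD('n) - 1 \<Longrightarrow> c * (norm (q l))\<^sup>2 \<le> ?E q s"
    by (rule energy_lower_bounds[OF c P]) (rule that)
  have VV0: "V k \<le> V 0" for k using Vdec by (simp add: decseq_def)
  have bound: "norm a \<le> sqrt (V 0 / d)" if "d > 0" "d * (norm a)\<^sup>2 \<le> V k" for d k and a :: "'z::real_normed_vector"
    using that VV0[of k] by (intro real_le_rsqrt) (simp add: field_simps)
  define Y where "Y k = (Ut_times U (q k) :: real^'p^'n)" for k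
  \<comment> \<open>The index is shifted because \<open>s\<^sup>k\<close> is a subgradient of \<open>h\<close> at \<open>x\<^sup>k\<close> by the proximal step only for
    \<open>k \<ge> 1\<close>.\<close>
  have "bounded (range (\<lambda>k. (Y (Suc k), s (Suc k))))"
  proof -
    define K where "K = (\<Sum>i\<in>UNIV. \<Sum>l\<in>?I. \<bar>U l $ i\<bar> * sqrt (V 0 / c))"
    have "Y k - Ut_times U q1 \<in> cball 0 K" for k
    proof -
      have "norm (q k l - q1 l) \<le> sqrt (V 0 / c)" if "l < CARD('n) - 1" for l
        using bound[OF c] m(3)[OF that, of "\<lambda>l. q k l - q1 l" "s k - g1"] unfolding V_def by blast
      then have "norm (Ut_times U (\<lambda>l. q k l - q1 l) :: real^'p^'n) \<le> K"
        unfolding K_def by (rule norm_Ut_times_le)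
      then show ?thesis by (simp add: Y_def Ut_times_diff)
    qed
    then have "Y k \<in> (\<lambda>w. Ut_times U q1 + w) ` cball 0 K" for k
      by (intro image_eqI[of _ _ "Y k - Ut_times U q1"]) simp_all
    moreover have "s k - g1 \<in> cball 0 (sqrt (V 0 / m))" for k
      using bound[OF m(1) m(2)[of "s k - g1" "\<lambda>l. q k l - q1 l", folded V_def]] by simp
    then have "s k \<in> (\<lambda>w. g1 + w) ` cball 0 (sqrt (V 0 / m))" for k
      by (intro image_eqI[of _ _ "s k - g1"]) simp_all
    ultimately have "range (\<lambda>k. (Y (Suc k), s (Suc k)))
        \<subseteq> ((\<lambda>w. Ut_times U q1 + w) ` cball 0 K) \<times> ((\<lambda>w. g1 + w) ` cball 0 (sqrt (V 0 / m)))"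
      by blast
    then show ?thesis
      by (rule bounded_subset[rotated]) (intro bounded_Times bounded_translation bounded_cball)
  qed
  then obtain lim \<rho> where \<rho>: "strict_mono (\<rho> :: nat \<Rightarrow> nat)"
    and lim: "((\<lambda>k. (Y (Suc k), s (Suc k))) \<circ> \<rho>) \<longlonglongrightarrow> lim"
    using bounded_imp_convergent_subsequence by blast
  obtain Y' s' where lim_eq: "lim = (Y', s')" by (cases lim)
  have Ylim: "(\<lambda>k. Y (Suc (\<rho> k))) \<longlonglongrightarrow> Y'" and slim: "(\<lambda>k. s (Suc (\<rho> k))) \<longlonglongrightarrow> s'"
    using tendsto_fst[OF lim] tendsto_snd[OF lim] by (simp_all add: o_def lim_eq)

  \<comment> \<open>The rows of every \<open>U\<^sup>T q\<close> sum to zero. This passes to the limit, so \<open>Y'\<close> is in the range of \<open>U\<^sup>T\<close>.\<close>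
  have "(\<lambda>k. \<Sum>i\<in>UNIV. Y (Suc (\<rho> k)) $ i) \<longlonglongrightarrow> (\<Sum>i\<in>UNIV. Y' $ i)"
    by (intro tendsto_intros Ylim)
  then have "(\<Sum>i\<in>UNIV. Y' $ i) = 0"
    by (simp add: Y_def sum_Ut_times[OF N] LIMSEQ_const_iff)
  then obtain q' where q': "Ut_times U q' = Y'"
    using Ut_times_surj_sum_zero[OF N] by metis
  define x' where "x' = r - c *\<^sub>R Y'"
  have xexp: "x (Suc k) = mat_times P (s k - s (Suc k)) + r - c *\<^sub>R Y (Suc k)" for k
    unfolding res Y_def by simp
  have Plim: "(\<lambda>k. mat_times P (s k - s (Suc k))) \<longlonglongrightarrow> 0"
    using tendsto_mat_times[OF step0(1), of P] by (simp add: linear_0[OF linear_mat_times])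
  have xlim: "(\<lambda>k. x (Suc (\<rho> k))) \<longlonglongrightarrow> x'"
  proof -
    have "(\<lambda>k. mat_times P (s (\<rho> k) - s (Suc (\<rho> k)))) \<longlonglongrightarrow> 0"
      using LIMSEQ_subseq_LIMSEQ[OF Plim \<rho>] by (simp add: o_def)
    then have "(\<lambda>k. x (Suc (\<rho> k))) \<longlonglongrightarrow> 0 + r - c *\<^sub>R Y'"
      unfolding xexp by (intro tendsto_intros Ylim)
    then show ?thesis by (simp add: x'_def)
  qed
  have sub': "is_subgradient (h_fun (f i) (\<Omega> i)) (x' $ i) (s' $ i)" for i
    by (rule subgradient_limit[OF f \<Omega> sub tendsto_vec_nth[OF xlim] tendsto_vec_nth[OF slim]])
  have dual': "x' - r + c *\<^sub>R Ut_times U q' = 0" by (simp add: x'_def q')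
  have cons': "\<forall>l<CARD('n) - 1. U_times U s' l = 0"
  proof (intro allI impI)
    fix l assume l: "l < CARD('n) - 1"
    have "(\<lambda>k. q k l - q (Suc k) l) \<longlonglongrightarrow> 0" by (rule step0(2)[OF l])
    then have "(\<lambda>k. - U_times U (s (Suc k)) l) \<longlonglongrightarrow> 0" by (simp add: q)
    then have "(\<lambda>k. U_times U (s (Suc k)) l) \<longlonglongrightarrow> 0" by (simp add: tendsto_minus_cancel_left[symmetric])
    then have "(\<lambda>k. U_times U (s (Suc (\<rho> k))) l) \<longlonglongrightarrow> 0"
      using LIMSEQ_subseq_LIMSEQ[OF _ \<rho>] by (force simp: o_def)
    then show "U_times U s' l = 0"
      using tendsto_U_times[OF slim] LIMSEQ_unique by blast
  qed
  have "is_z_star f \<Omega> r U c x' (stack q' s')"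
    using sub' dual' cons' unfolding is_z_star_def by blast
  then have sol: "x' \<in> solutions f r \<Omega>" by (rule is_z_star_imp_solution[OF N])

  define W where "W k = ?E (\<lambda>l. q k l - q' l) (s k - s')" for k
  have "W \<longlonglongrightarrow> 0"
  proof (rule decseq_subseq_tendsto_zero)
    show "0 \<le> W k" for k by (simp add: W_def nonneg)
    show "W (Suc k) \<le> W k" for k
      using fejer[OF sub' dual' cons', of k] \<Delta>0[of k] unfolding W_def \<Delta>_def by linarith
    show "strict_mono (\<lambda>k. Suc (\<rho> k))" using \<rho> by (simp add: strict_mono_def)
    show "(\<lambda>k. W (Suc (\<rho> k))) \<longlonglongrightarrow> 0" unfolding W_def
    proof (rule tendsto_energy_zero)
      show "(\<lambda>k. s (Suc (\<rho> k)) - s') \<longlonglongrightarrow> 0" using slim by (simp add: LIM_zero_iff)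
      obtain D :: "nat \<Rightarrow> real^'n" where
        D: "\<And>(q :: nat \<Rightarrow> real^'p) l. l < CARD('n) - 1 \<Longrightarrow> U_times D (Ut_times U q) l = q l"
        by (rule Ut_times_left_inverse[OF rank]) (rule that)
      fix l assume l: "l < CARD('n) - 1"
      have "(\<lambda>k. U_times D (Y (Suc (\<rho> k))) l) \<longlonglongrightarrow> U_times D (Ut_times U q') l"
        unfolding q' by (rule tendsto_U_times[OF Ylim])
      then have "(\<lambda>k. q (Suc (\<rho> k)) l) \<longlonglongrightarrow> q' l"
        unfolding Y_def D[OF l] .
      then show "(\<lambda>k. q (Suc (\<rho> k)) l - q' l) \<longlonglongrightarrow> 0" by (simp add: LIM_zero_iff)
    qed
  qed
  from energy_tendsto_zeroD(2)[OF c P this[unfolded W_def]]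
  have "(\<lambda>k. q k l) \<longlonglongrightarrow> q' l" if "l < CARD('n) - 1" for l
    using that by (simp add: LIM_zero_iff)
  then have "Y \<longlonglongrightarrow> Y'" unfolding Y_def q'[symmetric] by (rule tendsto_Ut_times)
  then have "(\<lambda>k. x (Suc k)) \<longlonglongrightarrow> 0 + r - c *\<^sub>R Y'"
    unfolding xexp by (intro tendsto_intros Plim LIMSEQ_Suc[of Y])
  then have "x \<longlonglongrightarrow> x'" unfolding x'_def by (simp add: LIMSEQ_imp_Suc)
  with sol show ?thesis by blast
qed

theorem theorem1:
  fixes f :: "'n::finite \<Rightarrow> real^'p::finite \<Rightarrow> real"
    and \<Omega> :: "'n \<Rightarrow> (real^'p) set"
    and r :: "real^'p^'n"
    and E :: "'n set set"
    and L :: "real^'n^'n"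
    and U :: "nat \<Rightarrow> real^'n"
    and \<beta> :: "'n \<Rightarrow> real"
    and c :: real
  assumes "\<And>i. convex_on UNIV (f i)"
    and "\<And>i. \<Omega> i \<noteq> {} \<and> closed (\<Omega> i) \<and> convex (\<Omega> i)"
    and "simple_graph E" and "graph_connected E"
    and "graph_compatible E L"
    and "L = gram_U U" and "full_row_rank U" and "null_space_U U = range (\<lambda>a. vec a)"
    and "solutions f r \<Omega> \<noteq> {}"
    and "slater r \<Omega>"
    and "\<And>i. \<beta> i > 0" and "c > 0"
    and "pos_def (diag_mat \<beta> - c *\<^sub>R L)"
  shows "pos_def_on block_idx (block_M c (diag_mat \<beta>) L) \<and>
    (\<forall>x s y. mirror_p_extra f \<Omega> r E L \<beta> c x s y \<longrightarrow>
      (\<forall>xs\<in>solutions f r \<Omega>. \<forall>zs. is_z_star f \<Omega> r U c xs zs \<longrightarrow>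
        (\<forall>k. (wnorm block_idx (block_M c (diag_mat \<beta>) L) (\<lambda>a. z_seq U s k a - z_seq U s (Suc k) a))\<^sup>2
           \<le> (wnorm block_idx (block_M c (diag_mat \<beta>) L) (\<lambda>a. z_seq U s k a - zs a))\<^sup>2
            - (wnorm block_idx (block_M c (diag_mat \<beta>) L) (\<lambda>a. z_seq U s (Suc k) a - zs a))\<^sup>2)) \<and>
      (\<exists>xs\<in>solutions f r \<Omega>. x \<longlonglongrightarrow> xs))"
proof (intro conjI allI impI ballI)
  note f = assms(1) and N = assms(8) and rank = assms(7) and \<beta> = assms(11) and c = assms(12)
    and L = assms(5,6)
  let ?P = "diag_mat \<beta> - c *\<^sub>R L"
  have \<Omega>: "closed (\<Omega> i)" "convex (\<Omega> i)" for i using assms(2) by auto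
  have P: "pos_def ?P" by (rule assms(13))
  show "pos_def_on block_idx (block_M c (diag_mat \<beta>) L)"
    by (rule pos_def_on_block_M[OF c P])

  fix x s y assume m: "mirror_p_extra f \<Omega> r E L \<beta> c x s y"
  note sub = mirror_p_extra_subgradient[OF m f \<Omega>(2) \<beta>]
  note res = mirror_p_extra_residual[OF m L \<beta>]
  show "\<exists>xs\<in>solutions f r \<Omega>. x \<longlonglongrightarrow> xs"
  proof -
    obtain xs where xs: "xs \<in> solutions f r \<Omega>" using assms(9) by blast
    obtain zs where zs: "is_z_star f \<Omega> r U c xs zs"
      by (rule solution_imp_is_z_star[OF f \<Omega>(2) N c xs assms(10)]) (rule that)
    show ?thesis
      by (rule mirror_p_extra_converges[where f = f and \<Omega> = \<Omega> and x = x and s = s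
            and q = "\<lambda>k. q_seq U s (Suc k)", OF f \<Omega>(1) N rank c P sub res _ zs]) simp
  qed

  fix xs zs k assume "is_z_star f \<Omega> r U c xs zs"
  then obtain q g where zs: "zs = stack q g"
    and g: "\<And>i. is_subgradient (h_fun (f i) (\<Omega> i)) (xs $ i) (g $ i)"
    and dual: "xs - r + c *\<^sub>R Ut_times U q = 0" and g0: "\<forall>l<CARD('n) - 1. U_times U g l = 0"
    by (auto simp: is_z_star_def)
  let ?q = "\<lambda>k. q_seq U s (Suc k)"
  have stack_diff: "(\<lambda>a. stack u t a - stack u' t' a) = stack (\<lambda>l. u l - u' l) (t - t')"
    for u u' :: "nat \<Rightarrow> real^'p" and t t' :: "real^'p^'n"
    by (auto simp: fun_eq_iff stack_def split: sum.split)
  have "0 \<le> (x (Suc k) - xs) \<bullet> (s (Suc k) - g)"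
    using subgradient_monotone[OF sub g]
    by (simp add: inner_vec_def[of "x (Suc k) - xs"] sum_nonneg)
  moreover have "energy c ?P (\<lambda>l. ?q k l - ?q (Suc k) l) (s k - s (Suc k))
    = energy c ?P (\<lambda>l. ?q k l - q l) (s k - g) - energy c ?P (\<lambda>l. ?q (Suc k) l - q l) (s (Suc k) - g)
      - 2 * ((x (Suc k) - xs) \<bullet> (s (Suc k) - g))"
    using P by (intro fejer_identity[OF _ res _ dual g0]) (auto simp: pos_def_def pos_def_on_def)
  ultimately show "(wnorm block_idx (block_M c (diag_mat \<beta>) L) (\<lambda>a. z_seq U s k a - z_seq U s (Suc k) a))\<^sup>2
      \<le> (wnorm block_idx (block_M c (diag_mat \<beta>) L) (\<lambda>a. z_seq U s k a - zs a))\<^sup>2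
       - (wnorm block_idx (block_M c (diag_mat \<beta>) L) (\<lambda>a. z_seq U s (Suc k) a - zs a))\<^sup>2"
    unfolding z_seq_def zs stack_diff wnorm_stack_squared[OF energy_nonneg[OF c P]] by linarith
qed

end
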